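(* In the coarsely Lipschitz category $\overline{\mathsf{CLip}}$ the following hold. (a) Every effective epi is a regular epi; every split epi is a regular epi; every regular epi is a strong epi; every strong epi is an extremal epi; every extremal epi is an epi; and every extremal epi is a regular epi. (In particular, regular, strong and extremal epis coincide.) (b) None of the following implications holds in general, i.e. for each of them there is a morphism of $\overline{\mathsf{CLip}}$ having the first property but not the second: epi $\Rightarrow$ extremal epi; regular epi $\Rightarrow$ effective epi; regular epi $\Rightarrow$ split epi; split epi $\Rightarrow$ effective epi; effective epi $\Rightarrow$ split epi.
   Context: All metric spaces are extended metric spaces (distances take values in $[0,\infty]$). Maps $f,g\colon X\to Y$ are close if there is $\kappa\ge 0$ with $d_Y(fx,gx)\le\kappa$ for all $x\in X$; $\bar f$ denotes the closeness class of $f$. A map $f\colon X\to Y$ is coarsely Lipschitz if it has an affine upper control, i.e. there are constants $a>0$, $b\ge 0$ with $d_Y(fx,fx')\le a\,d_X(x,x')+b$ for all $x,x'\in X$ with $d_X(x,x')<\infty$. The category $\overline{\mathsf{CLip}}$ has extended metric spaces as objects and closeness classes of coarsely Lipschitz maps as morphisms. In any category, an epimorphism $f\colon X\to Y$ is: an extremal epi if whenever $f=me$ with $m$ a mono, $m$ is an isomorphism; a strong epi if for every commutative square $mu=vf$ with $u\colon X\to A$, $v\colon Y\to B$ and $m\colon A\to B$ a mono there is a unique $d\colon Y\to A$ with $df=u$ and $md=v$; a regular epi if it is the coequaliser of some parallel pair; an effective epi if its kernel pair (the pullback of $f$ along $f$) exists and $f$ is the coequaliser of its kernel pair; a split epi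 if it admits a right inverse. *)

theory Defs
  imports Complex_Main "HOL-Library.Extended_Nonnegative_Real"
begin

section \<open>Categories and kinds of epimorphisms\<close>

text \<open>Composition is written in the usual order: \<open>Comp C g f\<close> is \<open>g\<close> after \<open>f\<close>.\<close>

record ('o, 'm) cat =
  Obj :: "'o set"
  Hom :: "'o \<Rightarrow> 'o \<Rightarrow> 'm set"
  Ident :: "'o \<Rightarrow> 'm"
  Comp :: "'m \<Rightarrow> 'm \<Rightarrow> 'm"

definition mor :: "('o, 'm, 'z) cat_scheme \<Rightarrow> 'o \<Rightarrow> 'o \<Rightarrow> 'm \<Rightarrow> bool" where
  "mor C X Y f \<longleftrightarrow> X \<in> Obj C \<and> Y \<in> Obj C \<and> f \<in> Hom C X Y"

definition category :: "('o, 'm, 'z) cat_scheme \<Rightarrow> bool" where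
  "category C \<longleftrightarrow>
     (\<forall>X\<in>Obj C. mor C X X (Ident C X)) \<and>
     (\<forall>X Y Z f g. mor C X Y f \<longrightarrow> mor C Y Z g \<longrightarrow> mor C X Z (Comp C g f)) \<and>
     (\<forall>X Y f. mor C X Y f \<longrightarrow> Comp C f (Ident C X) = f \<and> Comp C (Ident C Y) f = f) \<and>
     (\<forall>W X Y Z f g h. mor C W X f \<longrightarrow> mor C X Y g \<longrightarrow> mor C Y Z h \<longrightarrow>
        Comp C h (Comp C g f) = Comp C (Comp C h g) f) \<and>
     (\<forall>X Y X' Y' f. mor C X Y f \<longrightarrow> mor C X' Y' f \<longrightarrow> X = X' \<and> Y = Y')"

definition iso :: "('o, 'm, 'z) cat_scheme \<Rightarrow> 'o \<Rightarrow> 'o \<Rightarrow> 'm \<Rightarrow> bool" where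
  "iso C X Y f \<longleftrightarrow> mor C X Y f \<and>
     (\<exists>g. mor C Y X g \<and> Comp C g f = Ident C X \<and> Comp C f g = Ident C Y)"

definition monic :: "('o, 'm, 'z) cat_scheme \<Rightarrow> 'o \<Rightarrow> 'o \<Rightarrow> 'm \<Rightarrow> bool" where
  "monic C X Y f \<longleftrightarrow> mor C X Y f \<and>
     (\<forall>W u v. mor C W X u \<longrightarrow> mor C W X v \<longrightarrow> Comp C f u = Comp C f v \<longrightarrow> u = v)"

definition epi :: "('o, 'm, 'z) cat_scheme \<Rightarrow> 'o \<Rightarrow> 'o \<Rightarrow> 'm \<Rightarrow> bool" where
  "epi C X Y f \<longleftrightarrow> mor C X Y f \<and>
     (\<forall>Z u v. mor C Y Z u \<longrightarrow> mor C Y Z v \<longrightarrow> Comp C u f = Comp C v f \<longrightarrow> u = v)"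

text \<open>\<open>f : X \<rightarrow> Y\<close> is a coequaliser of \<open>p, q : W \<rightarrow> X\<close>.\<close>

definition coequaliser ::
  "('o, 'm, 'z) cat_scheme \<Rightarrow> 'o \<Rightarrow> 'o \<Rightarrow> 'o \<Rightarrow> 'm \<Rightarrow> 'm \<Rightarrow> 'm \<Rightarrow> bool" where
  "coequaliser C W X Y p q f \<longleftrightarrow>
     mor C W X p \<and> mor C W X q \<and> mor C X Y f \<and> Comp C f p = Comp C f q \<and>
     (\<forall>Z h. mor C X Z h \<longrightarrow> Comp C h p = Comp C h q \<longrightarrow>
        (\<exists>!k. mor C Y Z k \<and> Comp C k f = h))"

text \<open>\<open>P\<close> with projections \<open>p : P \<rightarrow> X\<close> and \<open>q : P \<rightarrow> Y\<close> is a pullback of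
  \<open>f : X \<rightarrow> Z\<close> and \<open>g : Y \<rightarrow> Z\<close>.\<close>

definition pullback ::
  "('o, 'm, 'z) cat_scheme \<Rightarrow> 'o \<Rightarrow> 'o \<Rightarrow> 'o \<Rightarrow> 'm \<Rightarrow> 'm \<Rightarrow> 'o \<Rightarrow> 'm \<Rightarrow> 'm \<Rightarrow> bool" where
  "pullback C X Y Z f g P p q \<longleftrightarrow>
     mor C X Z f \<and> mor C Y Z g \<and> mor C P X p \<and> mor C P Y q \<and> Comp C f p = Comp C g q \<and>
     (\<forall>W u v. mor C W X u \<longrightarrow> mor C W Y v \<longrightarrow> Comp C f u = Comp C g v \<longrightarrow>
        (\<exists>!h. mor C W P h \<and> Comp C p h = u \<and> Comp C q h = v))"

definition kernel_pair ::
  "('o, 'm, 'z) cat_scheme \<Rightarrow> 'o \<Rightarrow> 'o \<Rightarrow> 'm \<Rightarrow> 'o \<Rightarrow> 'm \<Rightarrow> 'm \<Rightarrow> bool" where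
  "kernel_pair C X Y f P p q \<longleftrightarrow> pullback C X X Y f f P p q"

definition extremal_epi :: "('o, 'm, 'z) cat_scheme \<Rightarrow> 'o \<Rightarrow> 'o \<Rightarrow> 'm \<Rightarrow> bool" where
  "extremal_epi C X Y f \<longleftrightarrow> epi C X Y f \<and>
     (\<forall>A e m. mor C X A e \<longrightarrow> monic C A Y m \<longrightarrow> f = Comp C m e \<longrightarrow> iso C A Y m)"

definition strong_epi :: "('o, 'm, 'z) cat_scheme \<Rightarrow> 'o \<Rightarrow> 'o \<Rightarrow> 'm \<Rightarrow> bool" where
  "strong_epi C X Y f \<longleftrightarrow> epi C X Y f \<and>
     (\<forall>A B u v m. mor C X A u \<longrightarrow> mor C Y B v \<longrightarrow> monic C A B m \<longrightarrow> Comp C m u = Comp C v f \<longrightarrow>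
        (\<exists>!d. mor C Y A d \<and> Comp C d f = u \<and> Comp C m d = v))"

definition regular_epi :: "('o, 'm, 'z) cat_scheme \<Rightarrow> 'o \<Rightarrow> 'o \<Rightarrow> 'm \<Rightarrow> bool" where
  "regular_epi C X Y f \<longleftrightarrow> epi C X Y f \<and> (\<exists>W p q. coequaliser C W X Y p q f)"

definition effective_epi :: "('o, 'm, 'z) cat_scheme \<Rightarrow> 'o \<Rightarrow> 'o \<Rightarrow> 'm \<Rightarrow> bool" where
  "effective_epi C X Y f \<longleftrightarrow> epi C X Y f \<and>
     (\<exists>P p q. kernel_pair C X Y f P p q \<and> coequaliser C P X Y p q f)"

definition split_epi :: "('o, 'm, 'z) cat_scheme \<Rightarrow> 'o \<Rightarrow> 'o \<Rightarrow> 'm \<Rightarrow> bool" where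
  "split_epi C X Y f \<longleftrightarrow> epi C X Y f \<and> (\<exists>s. mor C Y X s \<and> Comp C f s = Ident C Y)"


section \<open>Extended metric spaces and coarsely Lipschitz maps\<close>

text \<open>Only the values of \<open>edist X\<close> on \<open>pts X\<close> matter; two records that differ elsewhere are
  isomorphic via the identity.\<close>

record 'u emspace =
  pts :: "'u set"
  edist :: "'u \<Rightarrow> 'u \<Rightarrow> ennreal"

definition ext_metric :: "'u emspace \<Rightarrow> bool" where
  "ext_metric X \<longleftrightarrow>
     (\<forall>x\<in>pts X. \<forall>y\<in>pts X. edist X x y = 0 \<longleftrightarrow> x = y) \<and>
     (\<forall>x\<in>pts X. \<forall>y\<in>pts X. edist X x y = edist X y x) \<and>
     (\<forall>x\<in>pts X. \<forall>y\<in>pts X. \<forall>z\<in>pts X. edist X x z \<le> edist X x y + edist X y z)"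

definition close_maps :: "'u emspace \<Rightarrow> 'u emspace \<Rightarrow> ('u \<Rightarrow> 'u) \<Rightarrow> ('u \<Rightarrow> 'u) \<Rightarrow> bool" where
  "close_maps X Y f g \<longleftrightarrow>
     (\<exists>\<kappa>::real. \<kappa> \<ge> 0 \<and> (\<forall>x\<in>pts X. edist Y (f x) (g x) \<le> ennreal \<kappa>))"

definition coarsely_lipschitz :: "'u emspace \<Rightarrow> 'u emspace \<Rightarrow> ('u \<Rightarrow> 'u) \<Rightarrow> bool" where
  "coarsely_lipschitz X Y f \<longleftrightarrow> f ` pts X \<subseteq> pts Y \<and>
     (\<exists>a b::real. a > 0 \<and> b \<ge> 0 \<and>
        (\<forall>x\<in>pts X. \<forall>x'\<in>pts X. edist X x x' < \<infinity> \<longrightarrow>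
           edist Y (f x) (f x') \<le> ennreal a * edist X x x' + ennreal b))"

text \<open>Maps are total functions on the ambient type; a closeness class contains every function
  whose restriction to \<open>pts X\<close> is close to that of \<open>f\<close>, so values off \<open>pts X\<close> are irrelevant.\<close>

definition closeness_class :: "'u emspace \<Rightarrow> 'u emspace \<Rightarrow> ('u \<Rightarrow> 'u) \<Rightarrow> ('u \<Rightarrow> 'u) set" where
  "closeness_class X Y f = {g. coarsely_lipschitz X Y g \<and> close_maps X Y f g}"


section \<open>The coarsely Lipschitz category\<close>

text \<open>HOL has no type of all sets, so smallness is made relative to a collection \<open>U\<close> of
  sets over an arbitrary type, which has to be closed under subsets and (up to injection)
  binary products and to contain an infinite set. Examples are all subsets of an
  infinite type, and the small subsets of a type modelling the universe of sets; in
  the latter case \<open>CLip U\<close> is the category of all extended metric spaces.\<close>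

definition set_universe :: "'u set set \<Rightarrow> bool" where
  "set_universe U \<longleftrightarrow>
     (\<forall>A\<in>U. \<forall>B. B \<subseteq> A \<longrightarrow> B \<in> U) \<and>
     (\<forall>A\<in>U. \<forall>B\<in>U. \<exists>D\<in>U. \<exists>\<iota>. inj_on \<iota> (A \<times> B) \<and> \<iota> ` (A \<times> B) \<subseteq> D) \<and>
     (\<exists>A\<in>U. infinite A)"

type_synonym 'u clip_mor = "'u emspace \<times> ('u \<Rightarrow> 'u) set \<times> 'u emspace"

text \<open>A morphism is a triple of domain, closeness class and codomain.\<close>

definition CLip :: "'u set set \<Rightarrow> ('u emspace, 'u clip_mor) cat" where
  "CLip U = \<lparr>
     Obj = {X. ext_metric X \<and> pts X \<in> U},
     Hom = (\<lambda>X Y. {(X, closeness_class X Y f, Y) | f. coarsely_lipschitz X Y f}),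
     Ident = (\<lambda>X. (X, closeness_class X X (\<lambda>x. x), X)),
     Comp = (\<lambda>(Y', G, Z) (X, F, Y).
               (X, \<Union>g\<in>G. \<Union>f\<in>F. closeness_class X Z (g \<circ> f), Z)) \<rparr>"


subsection \<open>Well-definedness\<close>

lemma set_universe_UNIV:
  assumes "infinite (UNIV :: 'u set)"
  shows "set_universe (UNIV :: 'u set set)"
proof -
  obtain h :: "'u \<times> 'u \<Rightarrow> 'u" where "bij_betw h (UNIV \<times> UNIV) UNIV"
    using card_of_Times_same_infinite[OF assms, unfolded card_of_ordIso[symmetric]] by blast
  then have "inj h"
    by (simp add: bij_betw_def)
  then have "\<exists>\<iota>. inj_on \<iota> (A \<times> B) \<and> \<iota> ` (A \<times> B) \<subseteq> (UNIV :: 'u set)" for A B :: "'u set"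
    by (intro exI[of _ h]) (auto intro: inj_on_subset)
  then show ?thesis
    using assms unfolding set_universe_def by simp blast
qed

lemma close_maps_refl: "ext_metric Y \<Longrightarrow> f ` pts X \<subseteq> pts Y \<Longrightarrow> close_maps X Y f f"
  unfolding close_maps_def ext_metric_def by (intro exI[of _ "0::real"]) (simp add: image_subset_iff)

lemma close_maps_sym:
  assumes "ext_metric Y" "f ` pts X \<subseteq> pts Y" "g ` pts X \<subseteq> pts Y" "close_maps X Y f g"
  shows "close_maps X Y g f"
proof -
  have "edist Y (g x) (f x) = edist Y (f x) (g x)" if "x \<in> pts X" for x
    using assms(1-3) that unfolding ext_metric_def by blast
  then show ?thesis
    using assms(4) unfolding close_maps_def by simp
qed

lemma close_maps_trans:
  assumes Y: "ext_metric Y" and fgh: "f ` pts X \<subseteq> pts Y" "g ` pts X \<subseteq> pts Y" "h ` pts X \<subseteq> pts Y"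
    and fg: "close_maps X Y f g" and gh: "close_maps X Y g h"
  shows "close_maps X Y f h"
proof -
  obtain k where k: "k \<ge> 0" "\<And>x. x \<in> pts X \<Longrightarrow> edist Y (f x) (g x) \<le> ennreal k"
    using fg unfolding close_maps_def by blast
  obtain l where l: "l \<ge> 0" "\<And>x. x \<in> pts X \<Longrightarrow> edist Y (g x) (h x) \<le> ennreal l"
    using gh unfolding close_maps_def by blast
  have "edist Y (f x) (h x) \<le> ennreal (k + l)" if "x \<in> pts X" for x
  proof -
    have "edist Y (f x) (h x) \<le> edist Y (f x) (g x) + edist Y (g x) (h x)"
      using Y fgh that unfolding ext_metric_def by (simp add: image_subset_iff)
    also have "\<dots> \<le> ennreal k + ennreal l"
      using k(2) l(2) that by (intro add_mono) auto
    finally show ?thesis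
      using k(1) l(1) by simp
  qed
  then show ?thesis
    using k(1) l(1) unfolding close_maps_def by (intro exI[of _ "k + l"]) auto
qed

lemma coarsely_lipschitz_image: "coarsely_lipschitz X Y f \<Longrightarrow> f ` pts X \<subseteq> pts Y"
  unfolding coarsely_lipschitz_def by blast

lemma coarsely_lipschitz_id: "coarsely_lipschitz X X (\<lambda>x. x)"
  unfolding coarsely_lipschitz_def
  by (intro conjI exI[of _ "1::real"] exI[of _ "0::real"]) auto

lemma coarsely_lipschitz_comp:
  assumes f: "coarsely_lipschitz X Y f" and g: "coarsely_lipschitz Y Z g"
  shows "coarsely_lipschitz X Z (g \<circ> f)"
proof -
  obtain a b where ab: "a > 0" "b \<ge> 0"
    "\<And>x x'. x \<in> pts X \<Longrightarrow> x' \<in> pts X \<Longrightarrow> edist X x x' < \<infinity> \<Longrightarrow>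
       edist Y (f x) (f x') \<le> ennreal a * edist X x x' + ennreal b"
    using f unfolding coarsely_lipschitz_def by blast
  obtain c d where cd: "c > 0" "d \<ge> 0"
    "\<And>x x'. x \<in> pts Y \<Longrightarrow> x' \<in> pts Y \<Longrightarrow> edist Y x x' < \<infinity> \<Longrightarrow>
       edist Z (g x) (g x') \<le> ennreal c * edist Y x x' + ennreal d"
    using g unfolding coarsely_lipschitz_def by blast
  have "edist Z (g (f x)) (g (f x')) \<le> ennreal (c * a) * edist X x x' + ennreal (c * b + d)"
    if x: "x \<in> pts X" "x' \<in> pts X" "edist X x x' < \<infinity>" for x x'
  proof -
    have le: "edist Y (f x) (f x') \<le> ennreal a * edist X x x' + ennreal b"
      using ab(3) x by blast
    also have "\<dots> < \<infinity>"
      using x(3) by (simp add: ennreal_mult_less_top)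
    finally have fin: "edist Y (f x) (f x') < \<infinity>" .
    have "edist Z (g (f x)) (g (f x')) \<le> ennreal c * edist Y (f x) (f x') + ennreal d"
      using cd(3) fin x coarsely_lipschitz_image[OF f] by blast
    also have "\<dots> \<le> ennreal c * (ennreal a * edist X x x' + ennreal b) + ennreal d"
      using le by (intro add_mono mult_left_mono) auto
    also have "\<dots> = ennreal (c * a) * edist X x x' + ennreal (c * b + d)"
      using ab(1,2) cd(1,2) by (simp add: distrib_left ennreal_mult mult.assoc add.assoc)
    finally show ?thesis .
  qed
  moreover have "c * a > 0" "c * b + d \<ge> 0"
    using ab(1,2) cd(1,2) by auto
  moreover have "(g \<circ> f) ` pts X \<subseteq> pts Z"
    using coarsely_lipschitz_image[OF f] coarsely_lipschitz_image[OF g] by auto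
  ultimately show ?thesis
    unfolding coarsely_lipschitz_def comp_def by (intro conjI exI[of _ "c * a"] exI[of _ "c * b + d"]) auto
qed

lemma close_maps_postcomp:
  assumes g: "coarsely_lipschitz Y Z g" and ff': "close_maps X Y f f'"
    and img: "f ` pts X \<subseteq> pts Y" "f' ` pts X \<subseteq> pts Y"
  shows "close_maps X Z (g \<circ> f) (g \<circ> f')"
proof -
  obtain k where k: "k \<ge> 0" "\<And>x. x \<in> pts X \<Longrightarrow> edist Y (f x) (f' x) \<le> ennreal k"
    using ff' unfolding close_maps_def by blast
  obtain c d where cd: "c > 0" "d \<ge> 0"
    "\<And>x x'. x \<in> pts Y \<Longrightarrow> x' \<in> pts Y \<Longrightarrow> edist Y x x' < \<infinity> \<Longrightarrow>
       edist Z (g x) (g x') \<le> ennreal c * edist Y x x' + ennreal d"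
    using g unfolding coarsely_lipschitz_def by blast
  have "edist Z (g (f x)) (g (f' x)) \<le> ennreal (c * k + d)" if x: "x \<in> pts X" for x
  proof -
    have "edist Y (f x) (f' x) < \<infinity>"
      using k(2)[OF x] by (simp add: order_le_less_trans)
    then have "edist Z (g (f x)) (g (f' x)) \<le> ennreal c * edist Y (f x) (f' x) + ennreal d"
      using cd(3) img x by blast
    also have "\<dots> \<le> ennreal c * ennreal k + ennreal d"
      using k(2)[OF x] by (intro add_mono mult_left_mono) auto
    also have "\<dots> = ennreal (c * k + d)"
      using k(1) cd(1,2) by (simp add: ennreal_mult)
    finally show ?thesis .
  qed
  moreover have "c * k + d \<ge> 0"
    using k(1) cd(1,2) by simp
  ultimately show ?thesis
    unfolding close_maps_def comp_def by blast
qed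

lemma close_maps_precomp:
  "close_maps Y Z g g' \<Longrightarrow> f ` pts X \<subseteq> pts Y \<Longrightarrow> close_maps X Z (g \<circ> f) (g' \<circ> f)"
  unfolding close_maps_def comp_def by blast

lemma closeness_class_eq_iff:
  assumes "ext_metric Y" "coarsely_lipschitz X Y f" "coarsely_lipschitz X Y g"
  shows "closeness_class X Y f = closeness_class X Y g \<longleftrightarrow> close_maps X Y f g"
proof
  have "g \<in> closeness_class X Y g"
    using assms unfolding closeness_class_def
    by (simp add: close_maps_refl coarsely_lipschitz_image)
  moreover assume "closeness_class X Y f = closeness_class X Y g"
  ultimately show "close_maps X Y f g"
    unfolding closeness_class_def by blast
next
  assume fg: "close_maps X Y f g"
  note img = assms(2,3)[THEN coarsely_lipschitz_image]
  have gf: "close_maps X Y g f"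
    by (rule close_maps_sym[OF assms(1) img fg])
  have "close_maps X Y f h \<longleftrightarrow> close_maps X Y g h" if "coarsely_lipschitz X Y h" for h
    using close_maps_trans[OF assms(1) img(2,1) coarsely_lipschitz_image[OF that] gf]
      close_maps_trans[OF assms(1) img coarsely_lipschitz_image[OF that] fg] by blast
  then show "closeness_class X Y f = closeness_class X Y g"
    unfolding closeness_class_def by blast
qed

lemma Comp_CLip:
  assumes Y: "ext_metric Y" and Z: "ext_metric Z"
    and f: "coarsely_lipschitz X Y f" and g: "coarsely_lipschitz Y Z g"
  shows "Comp (CLip U) (Y, closeness_class Y Z g, Z) (X, closeness_class X Y f, Y) =
    (X, closeness_class X Z (g \<circ> f), Z)"
proof -
  have mem: "f \<in> closeness_class X Y f" "g \<in> closeness_class Y Z g"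
    using assms unfolding closeness_class_def
    by (simp_all add: close_maps_refl coarsely_lipschitz_image)
  have eq: "closeness_class X Z (g' \<circ> f') = closeness_class X Z (g \<circ> f)"
    if f': "f' \<in> closeness_class X Y f" and g': "g' \<in> closeness_class Y Z g" for f' g'
  proof -
    have c: "coarsely_lipschitz X Y f'" "coarsely_lipschitz Y Z g'"
      "close_maps X Y f f'" "close_maps Y Z g g'"
      using f' g' unfolding closeness_class_def by auto
    have 1: "close_maps X Z (g \<circ> f) (g \<circ> f')"
      using c f g by (intro close_maps_postcomp) (auto dest: coarsely_lipschitz_image)
    have 2: "close_maps X Z (g \<circ> f') (g' \<circ> f')"
      using c by (intro close_maps_precomp) (auto dest: coarsely_lipschitz_image)
    have L: "coarsely_lipschitz X Z (g \<circ> f)" "coarsely_lipschitz X Z (g \<circ> f')"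
      "coarsely_lipschitz X Z (g' \<circ> f')"
      using c f g by (auto intro: coarsely_lipschitz_comp)
    have "close_maps X Z (g \<circ> f) (g' \<circ> f')"
      by (rule close_maps_trans[OF Z L[THEN coarsely_lipschitz_image] 1 2])
    then show ?thesis
      using closeness_class_eq_iff[OF Z L(1,3)] by simp
  qed
  have "(\<Union>g'\<in>closeness_class Y Z g. \<Union>f'\<in>closeness_class X Y f. closeness_class X Z (g' \<circ> f'))
      = closeness_class X Z (g \<circ> f)"
    using mem eq by blast
  then show ?thesis
    unfolding CLip_def by simp
qed

lemma mor_CLip_iff:
  "mor (CLip U) X Y \<phi> \<longleftrightarrow> ext_metric X \<and> pts X \<in> U \<and> ext_metric Y \<and> pts Y \<in> U \<and>
     (\<exists>f. coarsely_lipschitz X Y f \<and> \<phi> = (X, closeness_class X Y f, Y))"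
  unfolding mor_def CLip_def by auto

lemma category_CLip: "category (CLip U)"
  unfolding category_def
proof (intro conjI ballI allI impI)
  fix X assume "X \<in> Obj (CLip U)"
  then show "mor (CLip U) X X (Ident (CLip U) X)"
    unfolding mor_CLip_iff by (auto simp: CLip_def intro: coarsely_lipschitz_id)
next
  fix X Y Z \<phi> \<psi> assume a: "mor (CLip U) X Y \<phi>" "mor (CLip U) Y Z \<psi>"
  then obtain f g where m: "ext_metric Y" "ext_metric Z"
    and c: "coarsely_lipschitz X Y f" "coarsely_lipschitz Y Z g"
    and e: "\<phi> = (X, closeness_class X Y f, Y)" "\<psi> = (Y, closeness_class Y Z g, Z)"
    unfolding mor_CLip_iff by blast
  show "mor (CLip U) X Z (Comp (CLip U) \<psi> \<phi>)"
    using a coarsely_lipschitz_comp[OF c] unfolding e Comp_CLip[OF m c] mor_CLip_iff by blast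
next
  fix X Y \<phi> assume "mor (CLip U) X Y \<phi>"
  then obtain f where f: "ext_metric X" "ext_metric Y" "coarsely_lipschitz X Y f"
    "\<phi> = (X, closeness_class X Y f, Y)"
    unfolding mor_CLip_iff by blast
  have I: "Ident (CLip U) W = (W, closeness_class W W (\<lambda>x. x), W)" for W
    by (simp add: CLip_def)
  have c: "f \<circ> (\<lambda>x. x) = f" "(\<lambda>x. x) \<circ> f = f"
    by auto
  show "Comp (CLip U) \<phi> (Ident (CLip U) X) = \<phi>" "Comp (CLip U) (Ident (CLip U) Y) \<phi> = \<phi>"
    using Comp_CLip[OF f(1,2) coarsely_lipschitz_id f(3)]
      Comp_CLip[OF f(2,2) f(3) coarsely_lipschitz_id] f(4)
    unfolding I c by simp_all
next
  fix W X Y Z \<phi> \<psi> \<chi>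
  assume a: "mor (CLip U) W X \<phi>" "mor (CLip U) X Y \<psi>" "mor (CLip U) Y Z \<chi>"
  then obtain f g h where m: "ext_metric X" "ext_metric Y" "ext_metric Z"
    and c: "coarsely_lipschitz W X f" "coarsely_lipschitz X Y g" "coarsely_lipschitz Y Z h"
    and e: "\<phi> = (W, closeness_class W X f, X)" "\<psi> = (X, closeness_class X Y g, Y)"
      "\<chi> = (Y, closeness_class Y Z h, Z)"
    unfolding mor_CLip_iff by blast
  show "Comp (CLip U) \<chi> (Comp (CLip U) \<psi> \<phi>) = Comp (CLip U) (Comp (CLip U) \<chi> \<psi>) \<phi>"
    unfolding e using m c
    by (simp add: Comp_CLip coarsely_lipschitz_comp comp_assoc)
next
  fix X Y X' Y' \<phi> assume "mor (CLip U) X Y \<phi>" "mor (CLip U) X' Y' \<phi>"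
  then show "X = X'" "Y = Y'"
    unfolding mor_CLip_iff by auto
qed

end

theory Submission
  imports Defs
begin

text \<open>Everything in (a) except extremal \<open>\<Rightarrow>\<close> regular holds in every category. For that one, give \<open>X\<close> the
  path metric in which one may either move in \<open>X\<close> at price \<open>1 + d\<^sub>X(x, x')\<close> or jump at the superlinear
  price \<open>1 + d\<^sub>Y(f x, f x')\<^sup>2\<close>. The induced map from this space to \<open>Y\<close> is a mono through which \<open>f\<close>
  factors, so it is an isomorphism when \<open>f\<close> is extremal. The path metric is then linear in
  \<open>d\<^sub>Y(f x, f x')\<close>, hence long jumps are never economical, and \<open>f\<close> is the coequaliser of the pairs whose
  images are at bounded distance. The counterexamples are star-shaped metrics on the naturals.\<close>

section \<open>Epimorphisms in an arbitrary category\<close>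

text \<open>For an arrow to be a mono it is enough that bounded distances between images come from
  bounded distances between points, with no restriction on how the second bound depends on the
  first; an isomorphism forces a linear dependence. The superlinear price lives in this gap. A
  linear price would give the induced map the bound of \<open>iso_clip_bound\<close> by
  construction, for every \<open>f\<close>, and extremality would say nothing. The danger in trading
  long jumps for shorter ones is that constants grow with every round. They do not: an estimate
  proportional to the price, once known for shorter jumps, adds up along a chain to the same
  multiple of the total, and the total is below the price of the jump replaced. For kernel pairs the
  obstacle is uniformity: the composites of \<open>f\<close> with the two projections are close with
  one fixed bound, whereas test pairs may be close with any bound. Hence everything depends on
  whether pairs with images at a larger distance can be moved, by a bounded amount, to pairs within
  the fixed bound. The last two examples lie on opposite sides of this question.\<close>

lemma
  assumes "category C"
  shows mor_Ident: "X \<in> Obj C \<Longrightarrow> mor C X X (Ident C X)"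
    and mor_Comp: "mor C X Y f \<Longrightarrow> mor C Y Z g \<Longrightarrow> mor C X Z (Comp C g f)"
    and Comp_Ident_right: "mor C X Y f \<Longrightarrow> Comp C f (Ident C X) = f"
    and Comp_Ident_left: "mor C X Y f \<Longrightarrow> Comp C (Ident C Y) f = f"
    and Comp_assoc: "mor C W X f \<Longrightarrow> mor C X Y g \<Longrightarrow> mor C Y Z h \<Longrightarrow>
      Comp C h (Comp C g f) = Comp C (Comp C h g) f"
  using assms unfolding category_def by metis+

text \<open>The section supplies the pair: \<open>f\<close> coequalises the identity and the
  idempotent \<open>Comp C s f\<close>, and a competing \<open>h\<close> factors as
  \<open>Comp C h s\<close>.\<close>

lemma split_epi_imp_regular_epi:
  assumes C: "category C" and f: "split_epi C X Y f"
  shows "regular_epi C X Y f"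
proof -
  obtain s where s: "mor C Y X s" "Comp C f s = Ident C Y" and e: "epi C X Y f"
    using f unfolding split_epi_def by blast
  have fm: "mor C X Y f"
    using e unfolding epi_def by blast
  have X: "X \<in> Obj C"
    using fm unfolding mor_def by blast
  have sf: "mor C X X (Comp C s f)"
    using mor_Comp[OF C fm s(1)] .
  have "Comp C f (Comp C s f) = f"
    using Comp_assoc[OF C fm s(1) fm] s(2) Comp_Ident_left[OF C fm] by simp
  moreover have "\<exists>!k. mor C Y Z k \<and> Comp C k f = h"
    if h: "mor C X Z h" "Comp C h (Ident C X) = Comp C h (Comp C s f)" for Z h
  proof
    show "mor C Y Z (Comp C h s) \<and> Comp C (Comp C h s) f = h"
      using mor_Comp[OF C s(1) h(1)] Comp_assoc[OF C fm s(1) h(1)] h(2) Comp_Ident_right[OF C h(1)]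
      by simp
    then show "k = Comp C h s" if "mor C Y Z k \<and> Comp C k f = h" for k
      using e that unfolding epi_def by metis
  qed
  ultimately have "coequaliser C X X Y (Ident C X) (Comp C s f) f"
    unfolding coequaliser_def
    using mor_Ident[OF C X] sf fm Comp_Ident_right[OF C fm] by simp
  then show ?thesis
    using e unfolding regular_epi_def by blast
qed

lemma effective_epi_imp_regular_epi: "effective_epi C X Y f \<Longrightarrow> regular_epi C X Y f"
  unfolding effective_epi_def regular_epi_def by blast

text \<open>Cancelling the mono \<open>m\<close> shows that \<open>u\<close> equalises the pair of
  which \<open>f\<close> is the coequaliser; the arrow so induced is the diagonal.\<close>

lemma regular_epi_imp_strong_epi:
  assumes C: "category C" and f: "regular_epi C X Y f"
  shows "strong_epi C X Y f"
  unfolding strong_epi_def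
proof (intro conjI allI impI)
  show e: "epi C X Y f"
    using f unfolding regular_epi_def by blast
  fix A B u v m
  assume u: "mor C X A u" and v: "mor C Y B v" and m: "monic C A B m"
    and sq: "Comp C m u = Comp C v f"
  obtain W p q where pq: "coequaliser C W X Y p q f"
    using f unfolding regular_epi_def by blast
  have mors: "mor C W X p" "mor C W X q" "mor C X Y f" "Comp C f p = Comp C f q" "mor C A B m"
    using pq m unfolding coequaliser_def monic_def by auto
  have "Comp C m (Comp C u p) = Comp C m (Comp C u q)"
    using Comp_assoc[OF C _ u mors(5)] mors sq Comp_assoc[OF C _ mors(3) v] by metis
  then have "Comp C u p = Comp C u q"
    using m mor_Comp[OF C mors(1) u] mor_Comp[OF C mors(2) u] unfolding monic_def by blast
  then obtain d where d: "mor C Y A d" "Comp C d f = u"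
    using pq u unfolding coequaliser_def by blast
  have "Comp C (Comp C m d) f = Comp C v f"
    using Comp_assoc[OF C mors(3) d(1) mors(5)] d(2) sq by simp
  then have "Comp C m d = v"
    using e v mor_Comp[OF C d(1) mors(5)] unfolding epi_def by blast
  moreover have "d' = d" if "mor C Y A d'" "Comp C d' f = u" for d'
    using e d that unfolding epi_def by metis
  ultimately show "\<exists>!d. mor C Y A d \<and> Comp C d f = u \<and> Comp C m d = v"
    using d by blast
qed

text \<open>The diagonal of the square whose side \<open>v\<close> is the identity of
  \<open>Y\<close> is a right inverse of \<open>m\<close>, and a mono with a right inverse is an
  isomorphism.\<close>

lemma strong_epi_imp_extremal_epi:
  assumes C: "category C" and f: "strong_epi C X Y f"
  shows "extremal_epi C X Y f"
  unfolding extremal_epi_def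
proof (intro conjI allI impI)
  show "epi C X Y f"
    using f unfolding strong_epi_def by blast
  then have fm: "mor C X Y f"
    unfolding epi_def by blast
  fix A e m
  assume e: "mor C X A e" and m: "monic C A Y m" and fme: "f = Comp C m e"
  have mm: "mor C A Y m"
    using m unfolding monic_def by blast
  have Ob: "Y \<in> Obj C" "A \<in> Obj C"
    using mm unfolding mor_def by auto
  have "Comp C m e = Comp C (Ident C Y) f"
    using fme Comp_Ident_left[OF C fm] by simp
  then obtain d where d: "mor C Y A d" "Comp C m d = Ident C Y"
    using f e m mor_Ident[OF C Ob(1)] unfolding strong_epi_def by blast
  have "Comp C m (Comp C d m) = Comp C m (Ident C A)"
    using Comp_assoc[OF C mm d(1) mm] d(2) Comp_Ident_left[OF C mm] Comp_Ident_right[OF C mm] by simp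
  then have "Comp C d m = Ident C A"
    using m mor_Comp[OF C mm d(1)] mor_Ident[OF C Ob(2)] unfolding monic_def by blast
  then show "iso C A Y m"
    using mm d unfolding iso_def by blast
qed

text \<open>Lets a coequaliser be found onto the fold space, where factorisations are immediate, and
  then be carried over to \<open>Y\<close>.\<close>

lemma coequaliser_Comp_iso:
  assumes C: "category C" and e: "coequaliser C W X A p q e" and m: "iso C A Y m"
  shows "coequaliser C W X Y p q (Comp C m e)"
proof -
  obtain g where g: "mor C A Y m" "mor C Y A g" "Comp C g m = Ident C A" "Comp C m g = Ident C Y"
    using m unfolding iso_def by blast
  have mors: "mor C W X p" "mor C W X q" "mor C X A e" "Comp C e p = Comp C e q"
    using e unfolding coequaliser_def by auto
  have "Comp C (Comp C m e) p = Comp C (Comp C m e) q"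
    using Comp_assoc[OF C _ mors(3) g(1)] mors by metis
  moreover have "\<exists>!k. mor C Y Z k \<and> Comp C k (Comp C m e) = h"
    if h: "mor C X Z h" "Comp C h p = Comp C h q" for Z h
  proof -
    obtain k where k: "mor C A Z k" "Comp C k e = h"
      and uniq: "\<And>k'. mor C A Z k' \<Longrightarrow> Comp C k' e = h \<Longrightarrow> k' = k"
      using e h unfolding coequaliser_def by metis
    show ?thesis
    proof
      have "Comp C (Comp C k g) (Comp C m e) = Comp C (Comp C (Comp C k g) m) e"
        using Comp_assoc[OF C mors(3) g(1) mor_Comp[OF C g(2) k(1)]] .
      also have "\<dots> = h"
        using Comp_assoc[OF C g(1,2) k(1)] g(3) Comp_Ident_right[OF C k(1)] k(2) by simp
      finally show "mor C Y Z (Comp C k g) \<and> Comp C (Comp C k g) (Comp C m e) = h"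
        using mor_Comp[OF C g(2) k(1)] by simp
      fix k' assume k': "mor C Y Z k' \<and> Comp C k' (Comp C m e) = h"
      have "Comp C k' m = k"
        using k' uniq mor_Comp[OF C g(1)] Comp_assoc[OF C mors(3) g(1)] by metis
      then show "k' = Comp C k g"
        using Comp_assoc[OF C g(2,1)] k' g(4) Comp_Ident_right[OF C] by metis
    qed
  qed
  ultimately show ?thesis
    using mors mor_Comp[OF C mors(3) g(1)] unfolding coequaliser_def by blast
qed


section \<open>Morphisms of the coarsely Lipschitz category\<close>

lemma
  assumes "ext_metric X"
  shows edist_self: "x \<in> pts X \<Longrightarrow> edist X x x = 0"
    and edist_zero_iff: "x \<in> pts X \<Longrightarrow> y \<in> pts X \<Longrightarrow> edist X x y = 0 \<longleftrightarrow> x = y"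
    and edist_sym: "x \<in> pts X \<Longrightarrow> y \<in> pts X \<Longrightarrow> edist X x y = edist X y x"
    and edist_triangle: "x \<in> pts X \<Longrightarrow> y \<in> pts X \<Longrightarrow> z \<in> pts X \<Longrightarrow>
      edist X x z \<le> edist X x y + edist X y z"
  using assms unfolding ext_metric_def by auto

lemma close_mapsI:
  assumes "\<And>x. x \<in> pts X \<Longrightarrow> edist Y (f x) (g x) \<le> ennreal k"
  shows "close_maps X Y f g"
  unfolding close_maps_def
proof (intro exI[of _ "\<bar>k\<bar>"] conjI ballI)
  fix x assume "x \<in> pts X"
  then show "edist Y (f x) (g x) \<le> ennreal \<bar>k\<bar>"
    using assms order_trans ennreal_leI[OF abs_ge_self] by blast
qed simp

text \<open>No finiteness condition is needed in this form, as \<open>K * (1 + \<infinity>) = \<infinity>\<close> for \<open>K > 0\<close>.\<close>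

lemma coarsely_lipschitz_iff:
  "coarsely_lipschitz X Y f \<longleftrightarrow> f ` pts X \<subseteq> pts Y \<and>
     (\<exists>K>0. \<forall>x\<in>pts X. \<forall>x'\<in>pts X. edist Y (f x) (f x') \<le> ennreal K * (1 + edist X x x'))"
proof (intro iffI conjI; (elim conjE)?)
  assume "coarsely_lipschitz X Y f"
  then obtain a b where ab: "a > 0" "b \<ge> 0"
    "\<And>x x'. x \<in> pts X \<Longrightarrow> x' \<in> pts X \<Longrightarrow> edist X x x' < \<infinity> \<Longrightarrow>
       edist Y (f x) (f x') \<le> ennreal a * edist X x x' + ennreal b"
    unfolding coarsely_lipschitz_def by blast
  have "edist Y (f x) (f x') \<le> ennreal (a + b) * (1 + edist X x x')"
    if x: "x \<in> pts X" "x' \<in> pts X" for x x'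
  proof (cases "edist X x x' < \<infinity>")
    case True
    have "edist Y (f x) (f x') \<le> ennreal a * edist X x x' + ennreal b"
      using ab(3) x True .
    also have "\<dots> \<le> ennreal (a + b) * edist X x x' + ennreal (a + b)"
      using ab(1,2) by (intro add_mono mult_right_mono ennreal_leI) auto
    finally show ?thesis
      by (simp add: distrib_left add.commute)
  next
    case False
    then show ?thesis
      using ab by (simp add: ennreal_mult_eq_top_iff less_top[symmetric])
  qed
  then show "\<exists>K>0. \<forall>x\<in>pts X. \<forall>x'\<in>pts X.
      edist Y (f x) (f x') \<le> ennreal K * (1 + edist X x x')"
    using ab by (intro exI[of _ "a + b"]) auto
next
  assume im: "f ` pts X \<subseteq> pts Y" and "\<exists>K>0. \<forall>x\<in>pts X. \<forall>x'\<in>pts X.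
      edist Y (f x) (f x') \<le> ennreal K * (1 + edist X x x')"
  then obtain K where "K > 0"
    "\<forall>x\<in>pts X. \<forall>x'\<in>pts X. edist Y (f x) (f x') \<le> ennreal K * (1 + edist X x x')"
    by blast
  then show "coarsely_lipschitz X Y f"
    unfolding coarsely_lipschitz_def using im
    by (intro conjI exI[of _ K]) (auto simp: distrib_left add.commute)
qed (rule coarsely_lipschitz_image)

lemma coarsely_lipschitzI:
  assumes "\<And>x. x \<in> pts X \<Longrightarrow> f x \<in> pts Y"
    and "\<And>x x'. x \<in> pts X \<Longrightarrow> x' \<in> pts X \<Longrightarrow> edist Y (f x) (f x') \<le> ennreal K * (1 + edist X x x')"
  shows "coarsely_lipschitz X Y f"
  unfolding coarsely_lipschitz_iff
proof (intro conjI exI[of _ "\<bar>K\<bar> + 1"] ballI)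
  fix x x' assume "x \<in> pts X" "x' \<in> pts X"
  then have "edist Y (f x) (f x') \<le> ennreal K * (1 + edist X x x')"
    by (rule assms(2))
  also have "\<dots> \<le> ennreal (\<bar>K\<bar> + 1) * (1 + edist X x x')"
    by (intro mult_right_mono ennreal_leI) auto
  finally show "edist Y (f x) (f x') \<le> ennreal (\<bar>K\<bar> + 1) * (1 + edist X x x')" .
qed (use assms(1) in auto)

lemma coarsely_lipschitzE:
  assumes "coarsely_lipschitz X Y f"
  obtains K where "K > 0" "\<And>x. x \<in> pts X \<Longrightarrow> f x \<in> pts Y"
    "\<And>x x'. x \<in> pts X \<Longrightarrow> x' \<in> pts X \<Longrightarrow> edist Y (f x) (f x') \<le> ennreal K * (1 + edist X x x')"
  using assms unfolding coarsely_lipschitz_iff by blast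

text \<open>For maps chosen pointwise, whose control is not visible: closeness to a controlled map
  is enough.\<close>

lemma coarsely_lipschitz_close:
  assumes Y: "ext_metric Y" and f: "coarsely_lipschitz X Y f"
    and g: "g ` pts X \<subseteq> pts Y" and gf: "close_maps X Y g f"
  shows "coarsely_lipschitz X Y g"
proof -
  obtain K where K: "K > 0" "\<And>x. x \<in> pts X \<Longrightarrow> f x \<in> pts Y"
    "\<And>x x'. x \<in> pts X \<Longrightarrow> x' \<in> pts X \<Longrightarrow> edist Y (f x) (f x') \<le> ennreal K * (1 + edist X x x')"
    using f by (rule coarsely_lipschitzE) blast
  obtain k where k: "k \<ge> 0" "\<And>x. x \<in> pts X \<Longrightarrow> edist Y (g x) (f x) \<le> ennreal k"
    using gf unfolding close_maps_def by blast
  show ?thesis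
  proof (rule coarsely_lipschitzI)
    fix x x' assume x: "x \<in> pts X" "x' \<in> pts X"
    have p: "g x \<in> pts Y" "g x' \<in> pts Y" "f x \<in> pts Y" "f x' \<in> pts Y"
      using x g K(2) by auto
    have "edist Y (g x) (g x') \<le> edist Y (g x) (f x) + (edist Y (f x) (f x') + edist Y (f x') (g x'))"
      using edist_triangle[OF Y] p by (meson add_left_mono order_trans)
    also have "\<dots> \<le> ennreal k + (ennreal K * (1 + edist X x x') + ennreal k)"
      using k(2) K(3) x edist_sym[OF Y] p by (intro add_mono) metis+
    also have "\<dots> \<le> ennreal (K + 2 * k) * (1 + edist X x x')"
    proof -
      have "ennreal k * 1 \<le> ennreal k * (1 + edist X x x')"
        by (intro mult_left_mono) auto
      then have "ennreal k + (ennreal K * (1 + edist X x x') + ennreal k)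
          \<le> ennreal k * (1 + edist X x x') + (ennreal K * (1 + edist X x x') + ennreal k * (1 + edist X x x'))"
        by (intro add_mono) auto
      also have "\<dots> = (ennreal k + (ennreal K + ennreal k)) * (1 + edist X x x')"
        by (simp only: distrib_right)
      also have "ennreal k + (ennreal K + ennreal k) = ennreal (K + 2 * k)"
        using k(1) K(1) by (simp flip: ennreal_plus)
      finally show ?thesis .
    qed
    finally show "edist Y (g x) (g x') \<le> ennreal (K + 2 * k) * (1 + edist X x x')" .
  qed (use g in auto)
qed

section \<open>Epis, monos, isomorphisms and coequalisers in terms of representatives\<close>

definition clip :: "'u emspace \<Rightarrow> 'u emspace \<Rightarrow> ('u \<Rightarrow> 'u) \<Rightarrow> 'u clip_mor" where
  "clip X Y f = (X, closeness_class X Y f, Y)"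

lemma Obj_CLip_iff: "X \<in> Obj (CLip U) \<longleftrightarrow> ext_metric X \<and> pts X \<in> U"
  by (simp add: CLip_def)

lemma mor_clip_iff:
  "mor (CLip U) X Y \<phi> \<longleftrightarrow> X \<in> Obj (CLip U) \<and> Y \<in> Obj (CLip U) \<and>
     (\<exists>f. coarsely_lipschitz X Y f \<and> \<phi> = clip X Y f)"
  unfolding mor_CLip_iff Obj_CLip_iff clip_def by blast

lemma Comp_clip:
  "Y \<in> Obj (CLip U) \<Longrightarrow> Z \<in> Obj (CLip U) \<Longrightarrow> coarsely_lipschitz X Y f \<Longrightarrow> coarsely_lipschitz Y Z g \<Longrightarrow>
    Comp (CLip U) (clip Y Z g) (clip X Y f) = clip X Z (g \<circ> f)"
  unfolding clip_def Obj_CLip_iff by (rule Comp_CLip) auto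

lemma Ident_clip: "Ident (CLip U) X = clip X X (\<lambda>x. x)"
  by (simp add: CLip_def clip_def)

lemma clip_eq_iff:
  "Y \<in> Obj (CLip U) \<Longrightarrow> coarsely_lipschitz X Y f \<Longrightarrow> coarsely_lipschitz X Y g \<Longrightarrow>
    clip X Y f = clip X Y g \<longleftrightarrow> close_maps X Y f g"
  unfolding clip_def by (simp add: closeness_class_eq_iff Obj_CLip_iff)

text \<open>Each point of \<open>Y\<close> is some \<open>f x\<close>, so a bound between
  \<open>u \<circ> f\<close> and \<open>v \<circ> f\<close> already is one between \<open>u\<close>
  and \<open>v\<close>.\<close>

lemma epi_clipI:
  assumes X: "X \<in> Obj (CLip U)" and Y: "Y \<in> Obj (CLip U)" and f: "coarsely_lipschitz X Y f"
    and surj: "\<And>y. y \<in> pts Y \<Longrightarrow> \<exists>x\<in>pts X. f x = y"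
  shows "epi (CLip U) X Y (clip X Y f)"
  unfolding epi_def
proof (intro conjI allI impI)
  show "mor (CLip U) X Y (clip X Y f)"
    using assms mor_clip_iff by blast
  fix Z \<phi> \<psi>
  assume "mor (CLip U) Y Z \<phi>" "mor (CLip U) Y Z \<psi>"
    and eq: "Comp (CLip U) \<phi> (clip X Y f) = Comp (CLip U) \<psi> (clip X Y f)"
  then obtain u v where uv: "\<phi> = clip Y Z u" "\<psi> = clip Y Z v" and Z: "Z \<in> Obj (CLip U)"
    and CL: "coarsely_lipschitz Y Z u" "coarsely_lipschitz Y Z v"
    unfolding mor_clip_iff by blast
  have "close_maps X Z (u \<circ> f) (v \<circ> f)"
    using eq unfolding uv
    by (simp add: Comp_clip[OF Y Z f] CL clip_eq_iff[OF Z] coarsely_lipschitz_comp[OF f])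
  then have "close_maps Y Z u v"
    unfolding close_maps_def comp_def using surj by metis
  then show "\<phi> = \<psi>"
    unfolding uv using clip_eq_iff[OF Z CL] by simp
qed

text \<open>The bound \<open>s\<close> may depend on \<open>r\<close> in any way, for instance
  quadratically; contrast the linear bound in \<open>iso_clip_bound\<close>.\<close>

lemma monic_clipI:
  assumes A: "A \<in> Obj (CLip U)" and B: "B \<in> Obj (CLip U)" and m: "coarsely_lipschitz A B m"
    and inj: "\<And>r. \<exists>s. \<forall>a\<in>pts A. \<forall>a'\<in>pts A. edist B (m a) (m a') \<le> ennreal r \<longrightarrow> edist A a a' \<le> ennreal s"
  shows "monic (CLip U) A B (clip A B m)"
  unfolding monic_def
proof (intro conjI allI impI)
  show "mor (CLip U) A B (clip A B m)"
    using assms mor_clip_iff by blast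
  fix W \<phi> \<psi>
  assume "mor (CLip U) W A \<phi>" "mor (CLip U) W A \<psi>"
    and eq: "Comp (CLip U) (clip A B m) \<phi> = Comp (CLip U) (clip A B m) \<psi>"
  then obtain u v where uv: "\<phi> = clip W A u" "\<psi> = clip W A v"
    and CL: "coarsely_lipschitz W A u" "coarsely_lipschitz W A v"
    unfolding mor_clip_iff by blast
  have "close_maps W B (m \<circ> u) (m \<circ> v)"
    using eq unfolding uv
    by (simp add: Comp_clip[OF A B _ m] CL clip_eq_iff[OF B] coarsely_lipschitz_comp[OF _ m])
  then obtain r where r: "\<And>w. w \<in> pts W \<Longrightarrow> edist B (m (u w)) (m (v w)) \<le> ennreal r"
    unfolding close_maps_def by auto
  obtain s where "\<forall>a\<in>pts A. \<forall>a'\<in>pts A. edist B (m a) (m a') \<le> ennreal r \<longrightarrow> edist A a a' \<le> ennreal s"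
    using inj by blast
  then have "close_maps W A u v"
    using r CL[THEN coarsely_lipschitz_image] by (intro close_mapsI[of _ _ _ _ s]) blast
  then show "\<phi> = \<psi>"
    unfolding uv using clip_eq_iff[OF A CL] by simp
qed

lemma iso_clipE:
  assumes "iso (CLip U) A B (clip A B m)" and m: "coarsely_lipschitz A B m"
  obtains g where "coarsely_lipschitz B A g" "close_maps A A (g \<circ> m) (\<lambda>x. x)"
proof -
  obtain \<gamma> where \<gamma>: "mor (CLip U) A B (clip A B m)" "mor (CLip U) B A \<gamma>"
    "Comp (CLip U) \<gamma> (clip A B m) = Ident (CLip U) A"
    using assms(1) unfolding iso_def by blast
  then obtain g where g: "\<gamma> = clip B A g" "coarsely_lipschitz B A g"
    and O: "A \<in> Obj (CLip U)" "B \<in> Obj (CLip U)"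
    unfolding mor_clip_iff by blast
  show ?thesis
  proof (rule that[OF g(2)])
    show "close_maps A A (g \<circ> m) (\<lambda>x. x)"
      using \<gamma>(3) unfolding g(1) Ident_clip
      by (simp add: Comp_clip[OF O(2,1) m g(2)] clip_eq_iff[OF O(1)] coarsely_lipschitz_comp[OF m g(2)]
          coarsely_lipschitz_id)
  qed
qed

lemma iso_clip_bound:
  assumes iso: "iso (CLip U) A B (clip A B m)" and m: "coarsely_lipschitz A B m"
  obtains K where "K > 0" "\<And>x x'. x \<in> pts A \<Longrightarrow> x' \<in> pts A \<Longrightarrow>
    edist A x x' \<le> ennreal K * (1 + edist B (m x) (m x'))"
proof -
  have A: "ext_metric A"
    using iso unfolding iso_def mor_CLip_iff by simp
  obtain g where g: "coarsely_lipschitz B A g" "close_maps A A (g \<circ> m) (\<lambda>x. x)"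
    using iso m by (rule iso_clipE)
  \<comment> \<open>The inequality sought says that the identity from \<open>A'\<close> to
    \<open>A\<close> is controlled. Over \<open>A'\<close> the map \<open>g \<circ> m\<close> is
    controlled because \<open>g\<close> is, and the identity is close to it. The pulled-back
    distance may be zero between different points.\<close>
  define A' where "A' = \<lparr>pts = pts A, edist = (\<lambda>x x'. edist B (m x) (m x'))\<rparr>"
  obtain L where L: "L > 0" "\<And>y. y \<in> pts B \<Longrightarrow> g y \<in> pts A"
    "\<And>y y'. y \<in> pts B \<Longrightarrow> y' \<in> pts B \<Longrightarrow> edist A (g y) (g y') \<le> ennreal L * (1 + edist B y y')"
    using g(1) by (rule coarsely_lipschitzE) blast
  have im: "m x \<in> pts B" if "x \<in> pts A" for x
    using coarsely_lipschitz_image[OF m] that by blast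
  have "coarsely_lipschitz A' A (g \<circ> m)"
    by (rule coarsely_lipschitzI[of _ _ _ L]) (simp_all add: A'_def L(2,3) im)
  moreover have "close_maps A A (\<lambda>x. x) (g \<circ> m)"
    using L(2) im by (intro close_maps_sym[OF A _ _ g(2)]) auto
  then have "close_maps A' A (\<lambda>x. x) (g \<circ> m)"
    by (simp add: close_maps_def A'_def)
  ultimately have "coarsely_lipschitz A' A (\<lambda>x. x)"
    using coarsely_lipschitz_close[OF A, of A' "g \<circ> m" "\<lambda>x. x"] by (simp add: A'_def)
  then obtain K where "K > 0" "\<And>x x'. x \<in> pts A' \<Longrightarrow> x' \<in> pts A' \<Longrightarrow>
      edist A x x' \<le> ennreal K * (1 + edist A' x x')"
    by (rule coarsely_lipschitzE) blast
  then show ?thesis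
    unfolding A'_def by (intro that[of K]) simp_all
qed

text \<open>Uniqueness of the factorisation comes from \<open>epi\<close>, which leaves only its
  existence up to closeness.\<close>

lemma coequaliser_clipI:
  assumes O: "W \<in> Obj (CLip U)" "X \<in> Obj (CLip U)" "Y \<in> Obj (CLip U)"
    and p: "coarsely_lipschitz W X p" and q: "coarsely_lipschitz W X q"
    and f: "coarsely_lipschitz X Y f" and fpq: "close_maps W Y (f \<circ> p) (f \<circ> q)"
    and epi: "epi (CLip U) X Y (clip X Y f)"
    and ex: "\<And>Z h. Z \<in> Obj (CLip U) \<Longrightarrow> coarsely_lipschitz X Z h \<Longrightarrow>
      close_maps W Z (h \<circ> p) (h \<circ> q) \<Longrightarrow> \<exists>k. coarsely_lipschitz Y Z k \<and> close_maps X Z (k \<circ> f) h"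
  shows "coequaliser (CLip U) W X Y (clip W X p) (clip W X q) (clip X Y f)"
  unfolding coequaliser_def
proof (intro conjI allI impI)
  show "mor (CLip U) W X (clip W X p)" "mor (CLip U) W X (clip W X q)" "mor (CLip U) X Y (clip X Y f)"
    using O p q f mor_clip_iff by blast+
  show "Comp (CLip U) (clip X Y f) (clip W X p) = Comp (CLip U) (clip X Y f) (clip W X q)"
    using fpq by (simp add: Comp_clip[OF O(2,3) _ f] p q clip_eq_iff[OF O(3)] coarsely_lipschitz_comp[OF _ f])
  fix Z \<eta> assume "mor (CLip U) X Z \<eta>"
    and eq: "Comp (CLip U) \<eta> (clip W X p) = Comp (CLip U) \<eta> (clip W X q)"
  then obtain h where h: "\<eta> = clip X Z h" "coarsely_lipschitz X Z h" and Z: "Z \<in> Obj (CLip U)"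
    unfolding mor_clip_iff by blast
  have "close_maps W Z (h \<circ> p) (h \<circ> q)"
    using eq unfolding h(1)
    by (simp add: Comp_clip[OF O(2) Z _ h(2)] p q clip_eq_iff[OF Z] coarsely_lipschitz_comp[OF _ h(2)])
  then obtain k where k: "coarsely_lipschitz Y Z k" "close_maps X Z (k \<circ> f) h"
    using ex[OF Z h(2)] by blast
  have "mor (CLip U) Y Z (clip Y Z k)"
    using k O Z mor_clip_iff by blast
  moreover have "Comp (CLip U) (clip Y Z k) (clip X Y f) = \<eta>"
    unfolding h(1) Comp_clip[OF O(3) Z f k(1)]
    using k(2) clip_eq_iff[OF Z coarsely_lipschitz_comp[OF f k(1)] h(2)] by simp
  ultimately show "\<exists>!k. mor (CLip U) Y Z k \<and> Comp (CLip U) k (clip X Y f) = \<eta>"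
    using epi unfolding epi_def by metis
qed


section \<open>Path metrics\<close>

text \<open>Intermediate points are forgotten: an infimum over paths needs only the endpoints and
  the total cost.\<close>

inductive chain :: "'a set \<Rightarrow> ('a \<Rightarrow> 'a \<Rightarrow> ennreal) \<Rightarrow> 'a \<Rightarrow> 'a \<Rightarrow> ennreal \<Rightarrow> bool" for S w where
  chain_refl: "x \<in> S \<Longrightarrow> chain S w x x 0"
| chain_step: "x \<in> S \<Longrightarrow> chain S w y z c \<Longrightarrow> chain S w x z (w x y + c)"

lemma chain_endpoints: "chain S w x y c \<Longrightarrow> x \<in> S \<and> y \<in> S"
  by (induction rule: chain.induct) auto

lemma chain_trans:
  "chain S w x y c \<Longrightarrow> chain S w y z e \<Longrightarrow> chain S w x z (c + e)"
proof (induction rule: chain.induct)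
  case (chain_step x y z' c)
  then show ?case
    using chain.chain_step[of x S w y z "c + e"] by (simp add: add.assoc)
qed simp

lemma chain_single: "x \<in> S \<Longrightarrow> y \<in> S \<Longrightarrow> chain S w x y (w x y)"
  using chain_step[OF _ chain_refl, of x S y w] by simp

lemma chain_sym:
  assumes "\<And>x y. x \<in> S \<Longrightarrow> y \<in> S \<Longrightarrow> w x y = w y x"
  shows "chain S w x y c \<Longrightarrow> chain S w y x c"
proof (induction rule: chain.induct)
  case (chain_step x y z c)
  have "y \<in> S"
    using chain_endpoints[OF chain_step(2)] by blast
  then show ?case
    using chain_trans[OF chain_step.IH chain_single[of y S x w]] chain_step(1) assms
    by (metis add.commute)
qed (rule chain_refl)

text \<open>The gap between \<open>0\<close> and \<open>1\<close> is what makes the path metric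
  separate points.\<close>

lemma chain_ge_one:
  assumes "\<And>x y. x \<in> S \<Longrightarrow> y \<in> S \<Longrightarrow> 1 \<le> w x y"
  shows "chain S w x y c \<Longrightarrow> x = y \<or> 1 \<le> c"
proof (induction rule: chain.induct)
  case (chain_step x y z c)
  then have "1 \<le> w x y"
    using assms chain_endpoints[OF chain_step(2)] by simp
  then show ?case
    using add_increasing2[of c 1 "w x y"] by simp
qed simp

text \<open>A step never costs more than the whole chain, so below the ceiling \<open>C\<close> the
  estimate is needed only for steps of cost at most \<open>C\<close>. The ceiling \<infinity> gives
  the plain bound; a finite one drives the induction on jump lengths.\<close>

lemma edist_le_chain:
  assumes Z: "ext_metric Z" and h: "h ` S \<subseteq> pts Z"
    and step: "\<And>x y. x \<in> S \<Longrightarrow> y \<in> S \<Longrightarrow> w x y \<le> C \<Longrightarrow> edist Z (h x) (h y) \<le> M * w x y"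
  shows "chain S w x y c \<Longrightarrow> c \<le> C \<Longrightarrow> edist Z (h x) (h y) \<le> M * c"
proof (induction rule: chain.induct)
  case (chain_refl x)
  then show ?case
    using edist_self[OF Z] h by auto
next
  case (chain_step x y z c)
  have S: "x \<in> S" "y \<in> S" "z \<in> S"
    using chain_step(1) chain_endpoints[OF chain_step(2)] by auto
  have le: "w x y \<le> C" "c \<le> C"
    using chain_step.prems order_trans[of "w x y" "w x y + c" C] order_trans[of c "w x y + c" C] by simp_all
  have "edist Z (h x) (h z) \<le> edist Z (h x) (h y) + edist Z (h y) (h z)"
    using S h by (intro edist_triangle[OF Z]) auto
  also have "\<dots> \<le> M * w x y + M * c"
    using step[OF S(1,2) le(1)] chain_step.IH[OF le(2)] by (rule add_mono)
  finally show ?case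
    by (simp add: distrib_left)
qed

text \<open>If an endpoint lies outside \<open>S\<close> there is no chain, and the infimum of the
  empty set is \<infinity>, so positive multiples of it bound every distance there.\<close>

definition path_metric :: "'a set \<Rightarrow> ('a \<Rightarrow> 'a \<Rightarrow> ennreal) \<Rightarrow> 'a \<Rightarrow> 'a \<Rightarrow> ennreal" where
  "path_metric S w x y = Inf {c. chain S w x y c}"

lemma path_metric_le: "x \<in> S \<Longrightarrow> y \<in> S \<Longrightarrow> path_metric S w x y \<le> w x y"
  unfolding path_metric_def by (intro Inf_lower) (simp add: chain_single)

lemma path_metric_less_iff: "path_metric S w x y < C \<longleftrightarrow> (\<exists>c. chain S w x y c \<and> c < C)"
  unfolding path_metric_def by (simp add: Inf_less_iff)

lemma edist_le_path_metric:
  assumes Z: "ext_metric Z" and h: "h ` S \<subseteq> pts Z"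
    and step: "\<And>x y. x \<in> S \<Longrightarrow> y \<in> S \<Longrightarrow> edist Z (h x) (h y) \<le> ennreal M * w x y"
    and M: "M > 0"
  shows "edist Z (h x) (h y) \<le> ennreal M * path_metric S w x y"
proof -
  \<comment> \<open>Dividing by \<open>M\<close> turns the claim into a lower bound for all chain
    costs, to which \<open>Inf_greatest\<close> applies.\<close>
  have inv: "ennreal (1 / M) * ennreal M = 1"
    using M by (simp flip: ennreal_mult)
  have "ennreal (1 / M) * edist Z (h x) (h y) \<le> c" if "chain S w x y c" for c
  proof -
    have "edist Z (h x) (h y) \<le> ennreal M * c"
      using edist_le_chain[OF Z h, of w \<infinity> "ennreal M"] step that by auto
    then have "ennreal (1 / M) * edist Z (h x) (h y) \<le> ennreal (1 / M) * (ennreal M * c)"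
      by (intro mult_left_mono) auto
    then show ?thesis
      by (simp only: mult.assoc[symmetric] inv mult_1_left)
  qed
  then have "ennreal (1 / M) * edist Z (h x) (h y) \<le> path_metric S w x y"
    unfolding path_metric_def by (intro Inf_greatest) auto
  then have "ennreal M * (ennreal (1 / M) * edist Z (h x) (h y)) \<le> ennreal M * path_metric S w x y"
    by (intro mult_left_mono) auto
  then show ?thesis
    by (simp only: mult.assoc[symmetric] inv[unfolded mult.commute[of "ennreal (1 / M)"]] mult_1_left)
qed

lemma path_metric_triangle:
  "path_metric S w x z \<le> path_metric S w x y + path_metric S w y z"
proof (rule ennreal_le_epsilon)
  fix e :: real
  assume fin: "path_metric S w x y + path_metric S w y z < top" and e: "0 < e"
  have less: "a < a + ennreal (e / 2)" if "a < top" for a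
    using that e by (cases a) (auto simp flip: ennreal_plus intro!: ennreal_lessI)
  have "path_metric S w x y < path_metric S w x y + ennreal (e / 2)"
    "path_metric S w y z < path_metric S w y z + ennreal (e / 2)"
    using fin e by (auto intro!: less)
  then obtain c c' where c: "chain S w x y c" "c < path_metric S w x y + ennreal (e / 2)"
    "chain S w y z c'" "c' < path_metric S w y z + ennreal (e / 2)"
    unfolding path_metric_less_iff by blast
  have "path_metric S w x z \<le> c + c'"
    unfolding path_metric_def using chain_trans[OF c(1,3)] by (intro Inf_lower) simp
  also have "\<dots> \<le> (path_metric S w x y + ennreal (e / 2)) + (path_metric S w y z + ennreal (e / 2))"
    using c(2,4) by (intro add_mono) auto
  also have "\<dots> = path_metric S w x y + path_metric S w y z + (ennreal (e / 2) + ennreal (e / 2))"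
    by (simp only: ac_simps)
  also have "ennreal (e / 2) + ennreal (e / 2) = ennreal e"
    using e by (simp flip: ennreal_plus)
  finally show "path_metric S w x z \<le> path_metric S w x y + path_metric S w y z + ennreal e" .
qed

lemma ext_metric_path_metric:
  assumes sym: "\<And>x y. x \<in> S \<Longrightarrow> y \<in> S \<Longrightarrow> w x y = w y x"
    and ge: "\<And>x y. x \<in> S \<Longrightarrow> y \<in> S \<Longrightarrow> 1 \<le> w x y"
  shows "ext_metric \<lparr>pts = S, edist = path_metric S w\<rparr>"
proof -
  have "path_metric S w x y = 0 \<longleftrightarrow> x = y" if "x \<in> S" for x y
  proof
    assume "path_metric S w x y = 0"
    then have "path_metric S w x y < 1"
      by simp
    then obtain c where c: "chain S w x y c" "c < 1"
      unfolding path_metric_less_iff by blast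
    then show "x = y"
      using chain_ge_one[OF ge c(1)] by auto
  next
    assume "x = y"
    then have "path_metric S w x y \<le> 0"
      unfolding path_metric_def using that by (intro Inf_lower) (simp add: chain_refl)
    then show "path_metric S w x y = 0"
      by simp
  qed
  moreover have "path_metric S w x y = path_metric S w y x" for x y
  proof -
    have "{c. chain S w x y c} = {c. chain S w y x c}"
      using chain_sym[of S w] sym by blast
    then show ?thesis
      unfolding path_metric_def by (rule arg_cong)
  qed
  ultimately show ?thesis
    unfolding ext_metric_def using path_metric_triangle by fastforce
qed


section \<open>Extremal epimorphisms are regular\<close>

text \<open>The summand \<open>1\<close> is invisible coarsely, but it keeps different points apart
  even where \<open>f\<close> identifies them.\<close>

definition fold_cost :: "'u emspace \<Rightarrow> 'u emspace \<Rightarrow> ('u \<Rightarrow> 'u) \<Rightarrow> 'u \<Rightarrow> 'u \<Rightarrow> ennreal" where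
  "fold_cost X Y f x x' = min (1 + edist X x x') (1 + (edist Y (f x) (f x'))\<^sup>2)"

definition fold_space :: "'u emspace \<Rightarrow> 'u emspace \<Rightarrow> ('u \<Rightarrow> 'u) \<Rightarrow> 'u emspace" where
  "fold_space X Y f = \<lparr>pts = pts X, edist = path_metric (pts X) (fold_cost X Y f)\<rparr>"

lemma pts_fold_space [simp]: "pts (fold_space X Y f) = pts X"
  by (simp add: fold_space_def)

lemma edist_fold_space_le:
  assumes "x \<in> pts X" "x' \<in> pts X"
  shows "edist (fold_space X Y f) x x' \<le> 1 + edist X x x'"
    and "edist (fold_space X Y f) x x' \<le> 1 + (edist Y (f x) (f x'))\<^sup>2"
  using path_metric_le[OF assms, of "fold_cost X Y f"]
  by (auto simp: fold_space_def fold_cost_def)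

lemma ext_metric_fold_space:
  assumes "ext_metric X" "ext_metric Y" "f ` pts X \<subseteq> pts Y"
  shows "ext_metric (fold_space X Y f)"
  unfolding fold_space_def
proof (rule ext_metric_path_metric)
  fix x y assume xy: "x \<in> pts X" "y \<in> pts X"
  then have "f x \<in> pts Y" "f y \<in> pts Y"
    using assms(3) by auto
  then show "fold_cost X Y f x y = fold_cost X Y f y x"
    unfolding fold_cost_def using edist_sym[OF assms(1) xy] edist_sym[OF assms(2)] by metis
qed (simp add: fold_cost_def)

lemma coarsely_lipschitz_to_fold_space: "coarsely_lipschitz X (fold_space X Y f) (\<lambda>x. x)"
  by (rule coarsely_lipschitzI[of _ _ _ 1]) (auto intro: edist_fold_space_le)

lemma le_1_plus_square_ennreal: "(t::ennreal) \<le> 1 + t\<^sup>2"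
proof (cases t)
  case (real r)
  have "0 \<le> (r - 1/2)\<^sup>2"
    by simp
  then have "r \<le> 1 + r\<^sup>2"
    by (simp add: power2_eq_square algebra_simps)
  then have "ennreal r \<le> ennreal (1 + r\<^sup>2)"
    by (rule ennreal_leI)
  then show ?thesis
    using real by (simp add: ennreal_power)
qed simp

text \<open>Both prices dominate the distance of the images up to a factor: moves by the control of
  \<open>f\<close>, jumps because \<open>t\<close> is at most \<open>1 + t\<^sup>2\<close>.\<close>

lemma coarsely_lipschitz_from_fold_space:
  assumes Y: "ext_metric Y" and f: "coarsely_lipschitz X Y f"
  shows "coarsely_lipschitz (fold_space X Y f) Y f"
proof -
  obtain K where K: "K > 0" "\<And>x. x \<in> pts X \<Longrightarrow> f x \<in> pts Y"
    "\<And>x x'. x \<in> pts X \<Longrightarrow> x' \<in> pts X \<Longrightarrow> edist Y (f x) (f x') \<le> ennreal K * (1 + edist X x x')"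
    using f by (rule coarsely_lipschitzE) blast
  have "edist Y (f x) (f x') \<le> ennreal (K + 1) * fold_cost X Y f x x'"
    if x: "x \<in> pts X" "x' \<in> pts X" for x x'
  proof -
    have "edist Y (f x) (f x') \<le> ennreal (K + 1) * (1 + edist X x x')"
      using K(1) by (intro order_trans[OF K(3)[OF x]] mult_right_mono ennreal_leI) auto
    moreover have "edist Y (f x) (f x') \<le> 1 * (1 + (edist Y (f x) (f x'))\<^sup>2)"
      using le_1_plus_square_ennreal by simp
    then have "edist Y (f x) (f x') \<le> ennreal (K + 1) * (1 + (edist Y (f x) (f x'))\<^sup>2)"
      using K(1) by (elim order_trans) (intro mult_right_mono, auto)
    ultimately show ?thesis
      unfolding fold_cost_def min_def by auto
  qed
  then have "edist Y (f x) (f x') \<le> ennreal (K + 1) * edist (fold_space X Y f) x x'" for x x'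
    unfolding fold_space_def emspace.simps
    by (rule edist_le_path_metric[OF Y coarsely_lipschitz_image[OF f]]) (use K(1) in auto)
  then have "edist Y (f x) (f x') \<le> ennreal (K + 1) * (1 + edist (fold_space X Y f) x x')" for x x'
    by (rule order_trans[OF _ mult_left_mono]) auto
  then show ?thesis
    using K(2) by (intro coarsely_lipschitzI[of _ _ _ "K + 1"]) simp_all
qed

text \<open>A single jump joins points whose images are \<open>r\<close> apart, at a price depending
  only on \<open>r\<close>.\<close>

lemma monic_fold_space:
  assumes X: "X \<in> Obj (CLip U)" and Y: "Y \<in> Obj (CLip U)" and f: "coarsely_lipschitz X Y f"
  shows "fold_space X Y f \<in> Obj (CLip U)"
    and "monic (CLip U) (fold_space X Y f) Y (clip (fold_space X Y f) Y f)"
proof -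
  show A: "fold_space X Y f \<in> Obj (CLip U)"
    using X Y ext_metric_fold_space[OF _ _ coarsely_lipschitz_image[OF f]] by (auto simp: Obj_CLip_iff)
  show "monic (CLip U) (fold_space X Y f) Y (clip (fold_space X Y f) Y f)"
  proof (rule monic_clipI[OF A Y])
    show "coarsely_lipschitz (fold_space X Y f) Y f"
      using Y f by (intro coarsely_lipschitz_from_fold_space) (simp_all add: Obj_CLip_iff)
    fix r :: real
    have "edist (fold_space X Y f) a a' \<le> ennreal (1 + r\<^sup>2)"
      if a: "a \<in> pts X" "a' \<in> pts X" "edist Y (f a) (f a') \<le> ennreal r" for a a'
    proof -
      have "edist (fold_space X Y f) a a' \<le> 1 + (edist Y (f a) (f a'))\<^sup>2"
        using a(1,2) by (rule edist_fold_space_le)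
      also have "\<dots> \<le> 1 + (ennreal \<bar>r\<bar>)\<^sup>2"
        using order_trans[OF a(3) ennreal_leI[OF abs_ge_self]] by (intro add_left_mono power_mono) auto
      also have "\<dots> = ennreal (1 + r\<^sup>2)"
        by (simp add: ennreal_power)
      finally show ?thesis .
    qed
    then show "\<exists>s. \<forall>a\<in>pts (fold_space X Y f). \<forall>a'\<in>pts (fold_space X Y f).
        edist Y (f a) (f a') \<le> ennreal r \<longrightarrow> edist (fold_space X Y f) a a' \<le> ennreal s"
      by (intro exI[of _ "1 + r\<^sup>2"]) auto
  qed
qed

text \<open>Origin of the threshold \<open>2 * K + 3\<close>: the excess of \<open>3\<close> over
  \<open>2 * K\<close> leaves \<open>3 * t\<close> to spare in the first claim, and
  \<open>t \<ge> 3\<close> makes \<open>(t - 1) * (t - 3)\<close> nonnegative, which is the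
  second.\<close>

lemma quadratic_gap:
  fixes K t s :: real
  assumes "0 < K" "2 * K + 3 \<le> t"
  shows "K * (1 + t) < (1 + t\<^sup>2) / 2"
    and "1 + s\<^sup>2 \<le> (1 + t\<^sup>2) / 2 \<Longrightarrow> s \<le> t - 1"
proof -
  have "3 * t \<le> (t - 2 * K) * t"
    using assms by (intro mult_right_mono) auto
  then show "K * (1 + t) < (1 + t\<^sup>2) / 2"
    using assms by (simp add: power2_eq_square algebra_simps)
  assume s: "1 + s\<^sup>2 \<le> (1 + t\<^sup>2) / 2"
  show "s \<le> t - 1"
  proof (rule ccontr)
    assume "\<not> s \<le> t - 1"
    then have "(t - 1)\<^sup>2 < s\<^sup>2"
      using assms by (intro power_strict_mono) auto
    moreover have "0 \<le> (t - 1) * (t - 3)"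
      using assms by (intro mult_nonneg_nonneg) auto
    ultimately show False
      using s by (simp add: power2_eq_square algebra_simps)
  qed
qed

text \<open>If the target carries the fold metric up to a linear error, the quadratic price of a long jump
  \<open>t\<close> exceeds twice the distance \<open>K * (1 + t)\<close>, so the jump can be replaced by a cheaper chain whose
  jumps are all shorter than \<open>t - 1\<close>. Hence jumps of length at most \<open>2 * K + 3\<close> already determine
  the fold space.\<close>

lemma coarsely_lipschitz_fold_space_descend:
  assumes Z: "ext_metric Z" and h: "coarsely_lipschitz X Z h" and K: "K > 0"
    and D: "\<And>x x'. x \<in> pts X \<Longrightarrow> x' \<in> pts X \<Longrightarrow>
      edist (fold_space X Y f) x x' \<le> ennreal K * (1 + edist Y (f x) (f x'))"
    and short: "\<And>x x'. x \<in> pts X \<Longrightarrow> x' \<in> pts X \<Longrightarrow>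
      edist Y (f x) (f x') \<le> ennreal (2 * K + 3) \<Longrightarrow> edist Z (h x) (h x') \<le> ennreal \<kappa>"
    and \<kappa>: "\<kappa> \<ge> 0"
  shows "coarsely_lipschitz (fold_space X Y f) Z h"
proof -
  obtain L where L: "L > 0" "\<And>x. x \<in> pts X \<Longrightarrow> h x \<in> pts Z"
    "\<And>x x'. x \<in> pts X \<Longrightarrow> x' \<in> pts X \<Longrightarrow> edist Z (h x) (h x') \<le> ennreal L * (1 + edist X x x')"
    using h by (rule coarsely_lipschitzE) blast
  \<comment> \<open>At least \<open>L\<close>, for the moves in \<open>X\<close>, and at least
    \<kappa>, for the base case, where a jump costs at least \<open>1\<close>.\<close>
  define M where "M = L + \<kappa>"
  have M: "M > 0"
    using L(1) \<kappa> by (simp add: M_def)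
  have dX: "edist Z (h x) (h x') \<le> ennreal M * (1 + edist X x x')" if x: "x \<in> pts X" "x' \<in> pts X" for x x'
    using \<kappa> by (intro order_trans[OF L(3)[OF x]] mult_right_mono ennreal_leI) (auto simp: M_def)
  \<comment> \<open>Each induction step lengthens the admissible jumps by one unit, while
    \<open>M\<close> is the same for all \<open>n\<close>.\<close>
  have jump: "edist Z (h x) (h x') \<le> ennreal M * (1 + (edist Y (f x) (f x'))\<^sup>2)"
    if "x \<in> pts X" "x' \<in> pts X" "edist Y (f x) (f x') \<le> ennreal (2 * K + 3 + real n)" for n x x'
    using that
  proof (induction n arbitrary: x x')
    case 0
    then have "edist Z (h x) (h x') \<le> ennreal \<kappa>"
      using short by simp
    also have "\<dots> \<le> ennreal M * 1"
      using L(1) by (simp add: M_def ennreal_leI)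
    also have "\<dots> \<le> ennreal M * (1 + (edist Y (f x) (f x'))\<^sup>2)"
      by (intro mult_left_mono) auto
    finally show ?case .
  next
    case (Suc n)
    show ?case
    proof (cases "edist Y (f x) (f x') \<le> ennreal (2 * K + 3 + real n)")
      case True
      then show ?thesis
        by (rule Suc.IH[OF Suc.prems(1,2)])
    next
      case False
      obtain t where t: "edist Y (f x) (f x') = ennreal t" "t \<ge> 0"
        using Suc.prems(3) by (cases "edist Y (f x) (f x')") (auto simp: top_unique)
      have "\<not> t \<le> 2 * K + 3 + real n"
        using False ennreal_leI unfolding t(1) by blast
      moreover have "0 \<le> 2 * K + 3 + real (Suc n)"
        using K by simp
      ultimately have tb: "2 * K + 3 + real n \<le> t" "t \<le> 2 * K + 3 + real (Suc n)"
        using Suc.prems(3) unfolding t(1) by (simp_all only: ennreal_le_iff)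
      \<comment> \<open>Half the price of the jump: more than the fold distance, so a chain cheaper
        than \<open>C\<close> exists, yet so little that its jumps are shorter by a full unit and
        fall under the induction hypothesis.\<close>
      define C where "C = (1 + t\<^sup>2) / 2"
      have "edist (fold_space X Y f) x x' \<le> ennreal K * (1 + ennreal t)"
        using D[OF Suc.prems(1,2)] unfolding t(1) .
      also have "\<dots> = ennreal (K * (1 + t))"
        using K t(2) by (simp add: ennreal_mult)
      also have "\<dots> < ennreal C"
        using quadratic_gap(1)[OF K, of t] tb(1) K t(2) unfolding C_def
          by (intro ennreal_lessI) (auto simp: add_pos_nonneg)
      finally obtain c where c: "chain (pts X) (fold_cost X Y f) x x' c" "c < ennreal C"
        unfolding fold_space_def emspace.simps path_metric_less_iff by blast
      have "edist Z (h y) (h y') \<le> ennreal M * fold_cost X Y f y y'"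
        if y: "y \<in> pts X" "y' \<in> pts X" "fold_cost X Y f y y' \<le> ennreal C" for y y'
      proof (cases "1 + edist X y y' \<le> 1 + (edist Y (f y) (f y'))\<^sup>2")
        case True
        then show ?thesis
          using dX[OF y(1,2)] unfolding fold_cost_def by (simp add: min_def)
      next
        case False
        then have eq: "fold_cost X Y f y y' = 1 + (edist Y (f y) (f y'))\<^sup>2"
          unfolding fold_cost_def by (simp add: min_def)
        obtain s where s: "edist Y (f y) (f y') = ennreal s" "s \<ge> 0"
          using y(3) unfolding eq by (cases "edist Y (f y) (f y')") (auto simp: top_unique)
        have "ennreal (1 + s\<^sup>2) \<le> ennreal C"
          using y(3) s(2) unfolding eq s(1) by (simp add: ennreal_power)
        then have "1 + s\<^sup>2 \<le> C"
          unfolding C_def by (subst (asm) ennreal_le_iff) auto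
        then have "s \<le> t - 1"
          using quadratic_gap(2)[OF K] tb(1) unfolding C_def by auto
        then have "edist Y (f y) (f y') \<le> ennreal (2 * K + 3 + real n)"
          using tb(2) unfolding s(1) by (intro ennreal_leI) auto
        then show ?thesis
          unfolding eq by (rule Suc.IH[OF y(1,2)])
      qed
      \<comment> \<open>Since \<open>c\<close> is below \<open>C\<close> and hence below the price
        of the original jump, the factor \<open>M\<close> comes back unchanged.\<close>
      then have "edist Z (h x) (h x') \<le> ennreal M * c"
        by (rule edist_le_chain[OF Z coarsely_lipschitz_image[OF h] _ c(1) less_imp_le[OF c(2)]])
      also have "\<dots> \<le> ennreal M * ennreal (1 + t\<^sup>2)"
        by (intro mult_left_mono order_trans[OF less_imp_le[OF c(2)]] ennreal_leI) (simp_all add: C_def)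
      finally show ?thesis
        using t by (simp add: ennreal_power)
    qed
  qed
  have "edist Z (h x) (h x') \<le> ennreal M * fold_cost X Y f x x'"
    if x: "x \<in> pts X" "x' \<in> pts X" for x x'
  proof -
    have "edist Z (h x) (h x') \<le> ennreal M * (1 + (edist Y (f x) (f x'))\<^sup>2)"
    proof (cases "edist Y (f x) (f x')")
      case (real t)
      obtain n where "t \<le> real n"
        using real_arch_simple by blast
      then have "edist Y (f x) (f x') \<le> ennreal (2 * K + 3 + real n)"
        unfolding real using K by (intro ennreal_leI) auto
      then show ?thesis
        by (rule jump[OF x])
    next
      case top
      then show ?thesis
        using M by (simp add: ennreal_mult_eq_top_iff)
    qed
    then show ?thesis
      using dX[OF x] unfolding fold_cost_def min_def by simp
  qed
  then have "edist Z (h x) (h x') \<le> ennreal M * edist (fold_space X Y f) x x'" for x x'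
    unfolding fold_space_def emspace.simps
    by (rule edist_le_path_metric[OF Z coarsely_lipschitz_image[OF h]]) (use M in auto)
  then have "edist Z (h x) (h x') \<le> ennreal M * (1 + edist (fold_space X Y f) x x')" for x x'
    by (rule order_trans[OF _ mult_left_mono]) auto
  then show ?thesis
    using L(2) by (intro coarsely_lipschitzI[of _ _ _ M]) simp_all
qed

section \<open>The coequalising pair inside the universe\<close>

definition discrete_space :: "'u set \<Rightarrow> 'u emspace" where
  "discrete_space S = \<lparr>pts = S, edist = (\<lambda>x y. if x = y then 0 else \<infinity>)\<rparr>"

lemma pts_discrete_space [simp]: "pts (discrete_space S) = S"
  by (simp add: discrete_space_def)

lemma ext_metric_discrete_space: "ext_metric (discrete_space S)"
  unfolding ext_metric_def discrete_space_def by auto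

text \<open>Different points are infinitely far apart, so control is a condition on the diagonal
  only. Any family of pairs of points can therefore be indexed by such a space.\<close>

lemma coarsely_lipschitz_discrete_space:
  "ext_metric X \<Longrightarrow> p ` S \<subseteq> pts X \<Longrightarrow> coarsely_lipschitz (discrete_space S) X p"
  by (rule coarsely_lipschitzI[of _ _ _ 1]) (auto simp: discrete_space_def edist_self)

text \<open>Pairs of points live in another type; \<iota> codes them in the ambient one, and closure
  under subsets keeps every coded relation in \<open>U\<close>.\<close>

lemma set_universe_pairs:
  assumes "set_universe U" "A \<in> U" "B \<in> U"
  obtains \<iota> where "inj_on \<iota> (A \<times> B)" "\<And>S. S \<subseteq> A \<times> B \<Longrightarrow> \<iota> ` S \<in> U"
proof -
  obtain D \<iota> where D: "D \<in> U" "inj_on \<iota> (A \<times> B)" "\<iota> ` (A \<times> B) \<subseteq> D"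
    using assms unfolding set_universe_def by meson
  moreover have "\<iota> ` S \<in> U" if "S \<subseteq> A \<times> B" for S
  proof -
    have "\<iota> ` S \<subseteq> D"
      using that D(3) by blast
    then show ?thesis
      using assms(1) D(1) unfolding set_universe_def by blast
  qed
  ultimately show ?thesis
    using that by blast
qed

lemma extremal_epi_imp_regular_epi:
  assumes U: "set_universe U" and ext: "extremal_epi (CLip U) X Y \<phi>"
  shows "regular_epi (CLip U) X Y \<phi>"
proof -
  have epi: "epi (CLip U) X Y \<phi>"
    using ext unfolding extremal_epi_def by blast
  then obtain f where \<phi>: "\<phi> = clip X Y f" and f: "coarsely_lipschitz X Y f"
    and X: "X \<in> Obj (CLip U)" and Y: "Y \<in> Obj (CLip U)"
    unfolding epi_def mor_clip_iff by blast
  have XY: "ext_metric X" "ext_metric Y"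
    using X Y by (simp_all add: Obj_CLip_iff)
  define A where "A = fold_space X Y f"
  have A: "A \<in> Obj (CLip U)" "ext_metric A" "pts A = pts X"
    using monic_fold_space(1)[OF X Y f] by (simp_all add: A_def Obj_CLip_iff)
  have e: "coarsely_lipschitz X A (\<lambda>x. x)"
    unfolding A_def by (rule coarsely_lipschitz_to_fold_space)
  have m: "coarsely_lipschitz A Y f"
    unfolding A_def using XY(2) f by (rule coarsely_lipschitz_from_fold_space)
  have fac: "\<phi> = Comp (CLip U) (clip A Y f) (clip X A (\<lambda>x. x))"
    unfolding \<phi> Comp_clip[OF A(1) Y e m] by (simp add: comp_def)
  have "mor (CLip U) X A (clip X A (\<lambda>x. x))"
    using X A(1) e mor_clip_iff by blast
  then have iso: "iso (CLip U) A Y (clip A Y f)"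
    using ext fac monic_fold_space(2)[OF X Y f] unfolding extremal_epi_def A_def by blast
  \<comment> \<open>This linear bound is all that extremality contributes.\<close>
  obtain K where K: "K > 0" "\<And>x x'. x \<in> pts X \<Longrightarrow> x' \<in> pts X \<Longrightarrow>
      edist A x x' \<le> ennreal K * (1 + edist Y (f x) (f x'))"
    using iso_clip_bound[OF iso m] unfolding A(3) by blast
  \<comment> \<open>The threshold is that of \<open>quadratic_gap\<close>: longer jumps follow from
    these.\<close>
  define E where "E = {z \<in> pts X \<times> pts X. edist Y (f (fst z)) (f (snd z)) \<le> ennreal (2 * K + 3)}"
  obtain \<iota> where \<iota>: "inj_on \<iota> (pts X \<times> pts X)" "\<And>S. S \<subseteq> pts X \<times> pts X \<Longrightarrow> \<iota> ` S \<in> U"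
    using set_universe_pairs[OF U, of "pts X" "pts X"] X unfolding Obj_CLip_iff by blast
  define W where "W = discrete_space (\<iota> ` E)"
  define p where "p = fst \<circ> inv_into E \<iota>"
  define q where "q = snd \<circ> inv_into E \<iota>"
  have E: "E \<subseteq> pts X \<times> pts X"
    unfolding E_def by blast
  have W: "W \<in> Obj (CLip U)" "pts W = \<iota> ` E"
    using \<iota>(2)[OF E] ext_metric_discrete_space by (auto simp: W_def Obj_CLip_iff)
  have pq: "p (\<iota> z) = fst z" "q (\<iota> z) = snd z" if "z \<in> E" for z
    using inv_into_f_f[OF inj_on_subset[OF \<iota>(1) E] that] by (simp_all add: p_def q_def)
  have CLpq: "coarsely_lipschitz W X p" "coarsely_lipschitz W X q"
    unfolding W_def using XY(1) pq E by (auto intro!: coarsely_lipschitz_discrete_space)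
  have close: "edist Z (h x) (h x') \<le> ennreal \<kappa>"
    if "\<forall>w\<in>pts W. edist Z ((h \<circ> p) w) ((h \<circ> q) w) \<le> ennreal \<kappa>"
      "x \<in> pts X" "x' \<in> pts X" "edist Y (f x) (f x') \<le> ennreal (2 * K + 3)" for Z h x x' \<kappa>
  proof -
    have "(x, x') \<in> E"
      using that(2-4) unfolding E_def by simp
    then show ?thesis
      using that(1) pq[of "(x, x')"] unfolding W(2) by force
  qed
  \<comment> \<open>The fold space has the points of \<open>X\<close>, so the factorisation of
    \<open>h\<close> is \<open>h\<close> itself and only its control is in question.\<close>
  have "coequaliser (CLip U) W X A (clip W X p) (clip W X q) (clip X A (\<lambda>x. x))"
  proof (rule coequaliser_clipI[OF W(1) X A(1) CLpq e])
    show "close_maps W A ((\<lambda>x. x) \<circ> p) ((\<lambda>x. x) \<circ> q)"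
    proof (rule close_mapsI)
      fix w assume "w \<in> pts W"
      then obtain z where z: "z \<in> E" "w = \<iota> z"
        unfolding W(2) by blast
      have "edist A (p w) (q w) \<le> ennreal K * (1 + edist Y (f (p w)) (f (q w)))"
        unfolding z(2) pq[OF z(1)] using z(1) E K(2) by (auto simp: mem_Times_iff)
      also have "\<dots> \<le> ennreal K * (1 + ennreal (2 * K + 3))"
        unfolding z(2) pq[OF z(1)] using z(1) by (intro mult_left_mono add_left_mono) (auto simp: E_def)
      also have "1 + ennreal (2 * K + 3) = ennreal (1 + (2 * K + 3))"
        using K(1) by (subst ennreal_plus) auto
      also have "ennreal K * ennreal (1 + (2 * K + 3)) = ennreal (K * (1 + (2 * K + 3)))"
        using K(1) by (intro ennreal_mult[symmetric]) auto
      finally show "edist A (((\<lambda>x. x) \<circ> p) w) (((\<lambda>x. x) \<circ> q) w) \<le> ennreal (K * (1 + (2 * K + 3)))"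
        by simp
    qed
    show "epi (CLip U) X A (clip X A (\<lambda>x. x))"
      using X A e by (intro epi_clipI) auto
    fix Z h
    assume Z: "Z \<in> Obj (CLip U)" and h: "coarsely_lipschitz X Z h"
      and "close_maps W Z (h \<circ> p) (h \<circ> q)"
    then obtain \<kappa> where \<kappa>: "\<kappa> \<ge> 0" "\<forall>w\<in>pts W. edist Z ((h \<circ> p) w) ((h \<circ> q) w) \<le> ennreal \<kappa>"
      unfolding close_maps_def by blast
    have Zm: "ext_metric Z"
      using Z by (simp add: Obj_CLip_iff)
    have "coarsely_lipschitz A Z h"
      unfolding A_def
      by (rule coarsely_lipschitz_fold_space_descend[OF Zm h K(1) K(2)[unfolded A_def] close[OF \<kappa>(2)] \<kappa>(1)])
    moreover have "close_maps X Z (h \<circ> (\<lambda>x. x)) h"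
      using close_maps_refl[OF Zm coarsely_lipschitz_image[OF h]] by (simp add: comp_def)
    ultimately show "\<exists>k. coarsely_lipschitz A Z k \<and> close_maps X Z (k \<circ> (\<lambda>x. x)) h"
      by blast
  qed
  then have "coequaliser (CLip U) W X Y (clip W X p) (clip W X q) \<phi>"
    unfolding fac using iso by (rule coequaliser_Comp_iso[OF category_CLip])
  then show ?thesis
    using epi unfolding regular_epi_def by blast
qed


section \<open>Counterexamples\<close>

text \<open>The metric on the leaves of a star-shaped tree, with leaf \<open>n\<close> at distance
  \<open>\<phi> n\<close> from a centre that is not itself a point.\<close>

definition star :: "(nat \<Rightarrow> ennreal) \<Rightarrow> nat \<Rightarrow> nat \<Rightarrow> ennreal" where
  "star \<phi> m n = (if m = n then 0 else \<phi> m + \<phi> n)"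

text \<open>The ambient type has no structure, so the examples are computed on the naturals and
  transported along an injection \<nu>.\<close>

definition nat_space :: "(nat \<Rightarrow> 'u) \<Rightarrow> nat set \<Rightarrow> (nat \<Rightarrow> nat \<Rightarrow> ennreal) \<Rightarrow> 'u emspace" where
  "nat_space \<nu> S \<delta> = \<lparr>pts = \<nu> ` S, edist = (\<lambda>x y. \<delta> (inv \<nu> x) (inv \<nu> y))\<rparr>"

definition nat_map :: "(nat \<Rightarrow> 'u) \<Rightarrow> (nat \<Rightarrow> nat) \<Rightarrow> 'u \<Rightarrow> 'u" where
  "nat_map \<nu> f x = \<nu> (f (inv \<nu> x))"

lemma pts_nat_space [simp]: "pts (nat_space \<nu> S \<delta>) = \<nu> ` S"
  by (simp add: nat_space_def)

lemma edist_nat_space [simp]: "inj \<nu> \<Longrightarrow> edist (nat_space \<nu> S \<delta>) (\<nu> m) (\<nu> n) = \<delta> m n"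
  by (simp add: nat_space_def)

lemma nat_map_apply [simp]: "inj \<nu> \<Longrightarrow> nat_map \<nu> f (\<nu> n) = \<nu> (f n)"
  by (simp add: nat_map_def)

lemma ext_metric_nat_space:
  assumes "inj \<nu>"
    and "\<And>m n. m \<in> S \<Longrightarrow> n \<in> S \<Longrightarrow> \<delta> m n = 0 \<longleftrightarrow> m = n"
    and "\<And>m n. m \<in> S \<Longrightarrow> n \<in> S \<Longrightarrow> \<delta> m n = \<delta> n m"
    and "\<And>l m n. l \<in> S \<Longrightarrow> m \<in> S \<Longrightarrow> n \<in> S \<Longrightarrow> \<delta> l n \<le> \<delta> l m + \<delta> m n"
  shows "ext_metric (nat_space \<nu> S \<delta>)"
  unfolding ext_metric_def pts_nat_space ball_simps(9) edist_nat_space[OF assms(1)]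
    inj_eq[OF assms(1)]
  using assms(2-4) by blast

lemma ext_metric_star:
  assumes "inj \<nu>" and "\<And>n. \<phi> n \<noteq> 0"
  shows "ext_metric (nat_space \<nu> S (star \<phi>))"
proof (rule ext_metric_nat_space[OF assms(1)])
  show "star \<phi> m n = 0 \<longleftrightarrow> m = n" for m n
    using assms(2)[of m] by (auto simp: star_def)
  show "star \<phi> m n = star \<phi> n m" for m n
    by (auto simp: star_def add.commute)
  show "star \<phi> l n \<le> star \<phi> l m + star \<phi> m n" for l m n
    by (auto simp: star_def add.assoc intro!: add_left_mono add_increasing)
qed

lemma coarsely_lipschitz_nat_space:
  assumes "inj \<nu>" and "\<And>n. n \<in> S \<Longrightarrow> f n \<in> T"
    and "\<And>m n. m \<in> S \<Longrightarrow> n \<in> S \<Longrightarrow> \<epsilon> (f m) (f n) \<le> ennreal K * (1 + \<delta> m n)"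
  shows "coarsely_lipschitz (nat_space \<nu> S \<delta>) (nat_space \<nu> T \<epsilon>) (nat_map \<nu> f)"
proof (rule coarsely_lipschitzI[of _ _ _ K])
  show "nat_map \<nu> f x \<in> pts (nat_space \<nu> T \<epsilon>)" if "x \<in> pts (nat_space \<nu> S \<delta>)" for x
    using that assms(1,2) by auto
  show "edist (nat_space \<nu> T \<epsilon>) (nat_map \<nu> f x) (nat_map \<nu> f x')
      \<le> ennreal K * (1 + edist (nat_space \<nu> S \<delta>) x x')"
    if "x \<in> pts (nat_space \<nu> S \<delta>)" "x' \<in> pts (nat_space \<nu> S \<delta>)" for x x'
    using that assms(1,3) by auto
qed

lemma set_universe_nat:
  assumes "set_universe (U :: 'u set set)"
  obtains \<nu> :: "nat \<Rightarrow> 'u" where "inj \<nu>" "\<And>S. \<nu> ` S \<in> U"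
proof -
  obtain A where A: "A \<in> U" "infinite A"
    using assms unfolding set_universe_def by blast
  obtain \<nu> :: "nat \<Rightarrow> 'u" where \<nu>: "inj \<nu>" "range \<nu> \<subseteq> A"
    using infinite_countable_subset[OF A(2)] by blast
  have "\<nu> ` S \<in> U" for S
  proof -
    have "\<nu> ` S \<subseteq> A"
      using \<nu>(2) by blast
    then show ?thesis
      using assms A(1) unfolding set_universe_def by blast
  qed
  then show ?thesis
    using that \<nu>(1) by blast
qed

text \<open>The identity from quadratic to linear weights is surjective, and a mono because a bound
  \<open>r\<close> downstairs gives \<open>r\<^sup>2\<close> upstairs, but no linear bound leads
  back. A mono that is an extremal epi would be an isomorphism, by factoring it through
  itself.\<close>

lemma epi_not_extremal_epi:
  assumes U: "set_universe (U :: 'u set set)"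
  shows "\<exists>X Y f. epi (CLip U) X Y f \<and> \<not> extremal_epi (CLip U) X Y f"
proof -
  obtain \<nu> :: "nat \<Rightarrow> 'u" where \<nu>: "inj \<nu>" "\<And>S. \<nu> ` S \<in> U"
    using set_universe_nat[OF U] by blast
  define X where "X = nat_space \<nu> UNIV (star (\<lambda>n. of_nat ((n + 1)\<^sup>2)))"
  define Y where "Y = nat_space \<nu> UNIV (star (\<lambda>n. of_nat (n + 1)))"
  have O: "X \<in> Obj (CLip U)" "Y \<in> Obj (CLip U)"
    using \<nu> ext_metric_star[OF \<nu>(1)] by (auto simp: Obj_CLip_iff X_def Y_def)
  have pX: "pts X = range \<nu>" "pts Y = range \<nu>"
    by (simp_all add: X_def Y_def)
  have dX: "edist X (\<nu> m) (\<nu> n) = of_nat (if m = n then 0 else (m + 1)\<^sup>2 + (n + 1)\<^sup>2)"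
    and dY: "edist Y (\<nu> m) (\<nu> n) = of_nat (if m = n then 0 else (m + 1) + (n + 1))" for m n
    using \<nu>(1) by (simp_all add: X_def Y_def star_def del: of_nat_add of_nat_Suc of_nat_power flip: of_nat_add)
  have f: "coarsely_lipschitz X Y (\<lambda>x. x)"
  proof (rule coarsely_lipschitzI[of _ _ _ 1])
    fix x x' assume "x \<in> pts X" "x' \<in> pts X"
    then obtain m n where mn: "x = \<nu> m" "x' = \<nu> n"
      unfolding pX by blast
    have "(m + 1) + (n + 1) \<le> (m + 1)\<^sup>2 + (n + 1)\<^sup>2"
      by (simp add: power2_eq_square)
    then have "edist Y x x' \<le> edist X x x'"
      unfolding mn dX dY of_nat_le_iff by simp
    then show "edist Y x x' \<le> ennreal 1 * (1 + edist X x x')"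
      by (simp add: add_increasing)
  qed (simp add: pX)
  have "monic (CLip U) X Y (clip X Y (\<lambda>x. x))"
  proof (rule monic_clipI[OF O f])
    fix r :: real
    have "edist X (\<nu> m) (\<nu> n) \<le> ennreal (r\<^sup>2)" if "edist Y (\<nu> m) (\<nu> n) \<le> ennreal r" for m n
    proof (cases "m = n")
      case False
      have "ennreal (real ((m + 1) + (n + 1))) \<le> ennreal r"
        using that False unfolding dY by (simp only: ennreal_of_nat_eq_real_of_nat if_False)
      then have "real ((m + 1) + (n + 1)) \<le> r"
        by (simp only: ennreal_le_iff2) auto
      then have "(real ((m + 1) + (n + 1)))\<^sup>2 \<le> r\<^sup>2"
        by (intro power_mono) auto
      moreover have "real ((m + 1)\<^sup>2 + (n + 1)\<^sup>2) \<le> (real ((m + 1) + (n + 1)))\<^sup>2"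
        by (simp add: power2_eq_square algebra_simps)
      ultimately have "ennreal (real ((m + 1)\<^sup>2 + (n + 1)\<^sup>2)) \<le> ennreal (r\<^sup>2)"
        by (intro ennreal_leI) linarith
      then show ?thesis
        using False unfolding dX by (simp only: ennreal_of_nat_eq_real_of_nat if_False)
    qed (simp add: dX)
    then show "\<exists>s. \<forall>a\<in>pts X. \<forall>a'\<in>pts X. edist Y a a' \<le> ennreal r \<longrightarrow> edist X a a' \<le> ennreal s"
      unfolding pX by blast
  qed
  moreover have "\<not> iso (CLip U) X Y (clip X Y (\<lambda>x. x))"
  proof
    assume "iso (CLip U) X Y (clip X Y (\<lambda>x. x))"
    then obtain K where K: "K > 0" "\<And>x x'. x \<in> pts X \<Longrightarrow> x' \<in> pts X \<Longrightarrow>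
        edist X x x' \<le> ennreal K * (1 + edist Y x x')"
      using f by (rule iso_clip_bound) blast
    \<comment> \<open>The points \<open>0\<close> and \<open>n\<close> are
      \<open>1 + (n + 1)\<^sup>2\<close> apart in \<open>X\<close> and \<open>n + 2\<close> apart in
      \<open>Y\<close>; beyond \<open>3 * K\<close> the linear bound fails for them.\<close>
    obtain n where n: "3 * K < real n"
      using reals_Archimedean2 by blast
    have n0: "0 \<noteq> n"
      using n K(1) by (cases n) auto
    have "ennreal (real ((0 + 1)\<^sup>2 + (n + 1)\<^sup>2)) \<le> ennreal K * (1 + ennreal (real ((0 + 1) + (n + 1))))"
      using K(2)[of "\<nu> 0" "\<nu> n"] n0 unfolding pX dX dY
      by (simp only: ennreal_of_nat_eq_real_of_nat if_False rangeI simp_thms)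
    also have "1 + ennreal (real ((0 + 1) + (n + 1))) = ennreal (real n + 3)"
      by (simp flip: ennreal_1 ennreal_plus)
    also have "ennreal K * \<dots> = ennreal (K * (real n + 3))"
      using K(1) by (intro ennreal_mult[symmetric]) auto
    finally have "real ((0 + 1)\<^sup>2 + (n + 1)\<^sup>2) \<le> K * (real n + 3)"
      using K(1) by (subst (asm) ennreal_le_iff) auto
    moreover have "3 * K * (real n + 3) \<le> real n * (real n + 3)"
      using n by (intro mult_right_mono) auto
    ultimately show False
      by (simp add: power2_eq_square algebra_simps) (use zero_le_square[of "real n"] in linarith)
  qed
  moreover have "clip X Y (\<lambda>x. x) = Comp (CLip U) (clip X Y (\<lambda>x. x)) (clip X X (\<lambda>x. x))"
    unfolding Comp_clip[OF O coarsely_lipschitz_id f] by (simp add: comp_def)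
  moreover have "mor (CLip U) X X (clip X X (\<lambda>x. x))"
    using O coarsely_lipschitz_id mor_clip_iff by blast
  ultimately have "\<not> extremal_epi (CLip U) X Y (clip X Y (\<lambda>x. x))"
    unfolding extremal_epi_def by blast
  moreover have "epi (CLip U) X Y (clip X Y (\<lambda>x. x))"
    by (rule epi_clipI[OF O f]) (simp add: pX)
  ultimately show ?thesis
    by blast
qed

text \<open>The tips \<open>\<nu> n\<close> with \<open>n\<close> odd are at infinite distance from every other point, so pairs of tips with
  images at arbitrarily large finite distance cannot be moved within a kernel pair.\<close>

lemma split_epi_not_effective_epi:
  assumes U: "set_universe (U :: 'u set set)"
  shows "\<exists>X Y f. split_epi (CLip U) X Y f \<and> \<not> effective_epi (CLip U) X Y f"
proof -
  obtain \<nu> :: "nat \<Rightarrow> 'u" where \<nu>: "inj \<nu>" "\<And>S. \<nu> ` S \<in> U"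
    using set_universe_nat[OF U] by blast
  \<comment> \<open>The infinite weight frees the odd points from any control condition, although
    their images spread without bound in \<open>Y\<close>.\<close>
  define \<phi> :: "nat \<Rightarrow> ennreal" where "\<phi> n = (if even n then of_nat (n + 1) else \<infinity>)" for n
  define X where "X = nat_space \<nu> UNIV (star \<phi>)"
  define Y where "Y = nat_space \<nu> {n. even n} (star \<phi>)"
  define r where "r n = (if even n then n else n - 1)" for n :: nat
  define f where "f = nat_map \<nu> r"
  have \<phi>0: "\<phi> n \<noteq> 0" for n
    by (simp add: \<phi>_def)
  have O: "X \<in> Obj (CLip U)" "Y \<in> Obj (CLip U)"
    using \<nu> ext_metric_star[OF \<nu>(1) \<phi>0] by (auto simp: Obj_CLip_iff X_def Y_def)
  have f: "coarsely_lipschitz X Y f"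
    unfolding X_def Y_def f_def
    by (rule coarsely_lipschitz_nat_space[OF \<nu>(1), where K = 1])
      (auto simp: star_def r_def \<phi>_def add_increasing)
  have s: "coarsely_lipschitz Y X (\<lambda>x. x)"
    by (rule coarsely_lipschitzI[of _ _ _ 1]) (auto simp: X_def Y_def \<nu>(1) add_increasing)
  have fs: "close_maps Y Y (f \<circ> (\<lambda>x. x)) (\<lambda>x. x)"
    by (rule close_mapsI[of _ _ _ _ 0]) (auto simp: Y_def f_def \<nu>(1) r_def star_def)
  have epi: "epi (CLip U) X Y (clip X Y f)"
  proof (rule epi_clipI[OF O f])
    fix y assume "y \<in> pts Y"
    then show "\<exists>x\<in>pts X. f x = y"
      by (intro bexI[of _ y]) (auto simp: X_def Y_def f_def \<nu>(1) r_def)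
  qed
  have "mor (CLip U) Y X (clip Y X (\<lambda>x. x))"
    using O s mor_clip_iff by blast
  moreover have "Comp (CLip U) (clip X Y f) (clip Y X (\<lambda>x. x)) = Ident (CLip U) Y"
    unfolding Comp_clip[OF O s f] Ident_clip
      clip_eq_iff[OF O(2) coarsely_lipschitz_comp[OF s f] coarsely_lipschitz_id] by (rule fs)
  ultimately have "split_epi (CLip U) X Y (clip X Y f)"
    using epi unfolding split_epi_def by blast
  moreover have "\<not> effective_epi (CLip U) X Y (clip X Y f)"
  proof
    assume "effective_epi (CLip U) X Y (clip X Y f)"
    then obtain P \<pi> \<rho> where pb: "pullback (CLip U) X X Y (clip X Y f) (clip X Y f) P \<pi> \<rho>"
      unfolding effective_epi_def kernel_pair_def by blast
    then have "mor (CLip U) P X \<pi>" "mor (CLip U) P X \<rho>"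
      and eq: "Comp (CLip U) (clip X Y f) \<pi> = Comp (CLip U) (clip X Y f) \<rho>"
      unfolding pullback_def by blast+
    then obtain p q where pq: "\<pi> = clip P X p" "\<rho> = clip P X q" "coarsely_lipschitz P X p"
      "coarsely_lipschitz P X q" and P: "P \<in> Obj (CLip U)"
      unfolding mor_clip_iff by blast
    have "close_maps P Y (f \<circ> p) (f \<circ> q)"
      using eq unfolding pq(1,2) Comp_clip[OF O pq(3) f] Comp_clip[OF O pq(4) f]
        clip_eq_iff[OF O(2) coarsely_lipschitz_comp[OF pq(3) f] coarsely_lipschitz_comp[OF pq(4) f]] .
    then obtain \<kappa> where \<kappa>: "\<And>z. z \<in> pts P \<Longrightarrow> edist Y (f (p z)) (f (q z)) \<le> ennreal \<kappa>" "\<kappa> \<ge> 0"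
      unfolding close_maps_def comp_def by blast
    \<comment> \<open>The tips \<open>1\<close> and \<open>2 * n + 1\<close> have images
      \<open>0\<close> and \<open>2 * n\<close>, further apart than the bound \<kappa> that holds on
      all of \<open>P\<close>.\<close>
    obtain n where n: "\<kappa> < real n"
      using reals_Archimedean2 by blast
    \<comment> \<open>A one-point test space: the two tips, as constant maps, have close images, so
      they must lift to a point of \<open>P\<close>.\<close>
    define W where "W = discrete_space {\<nu> 0}"
    have W: "W \<in> Obj (CLip U)"
      using \<nu>(2)[of "{0}"] ext_metric_discrete_space by (simp add: W_def Obj_CLip_iff)
    have Xm: "ext_metric X"
      using O(1) by (simp add: Obj_CLip_iff)
    have uv: "coarsely_lipschitz W X (\<lambda>_. \<nu> k)" for k
      unfolding W_def by (rule coarsely_lipschitz_discrete_space[OF Xm]) (simp add: X_def)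
    have st: "star \<phi> 0 (2 * n) = of_nat (if n = 0 then 0 else 2 * n + 2)"
      by (simp add: star_def \<phi>_def flip: add.assoc)
    have "close_maps W Y (f \<circ> (\<lambda>_. \<nu> 1)) (f \<circ> (\<lambda>_. \<nu> (2 * n + 1)))"
      by (rule close_mapsI[of _ _ _ _ "real (2 * n + 2)"])
        (simp add: Y_def f_def \<nu>(1) r_def W_def st ennreal_of_nat_eq_real_of_nat ennreal_leI del: of_nat_add of_nat_mult)
    then have "Comp (CLip U) (clip X Y f) (clip W X (\<lambda>_. \<nu> 1)) =
        Comp (CLip U) (clip X Y f) (clip W X (\<lambda>_. \<nu> (2 * n + 1)))"
      unfolding Comp_clip[OF O uv f] clip_eq_iff[OF O(2) coarsely_lipschitz_comp[OF uv f] coarsely_lipschitz_comp[OF uv f]] .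
    moreover have "mor (CLip U) W X (clip W X (\<lambda>_. \<nu> k))" for k
      using W O(1) uv mor_clip_iff by blast
    ultimately obtain \<eta> where "mor (CLip U) W P \<eta>" and e: "Comp (CLip U) \<pi> \<eta> = clip W X (\<lambda>_. \<nu> 1)"
      "Comp (CLip U) \<rho> \<eta> = clip W X (\<lambda>_. \<nu> (2 * n + 1))"
      using pb unfolding pullback_def by blast
    then obtain h where h: "\<eta> = clip W P h" "coarsely_lipschitz W P h"
      unfolding mor_clip_iff by blast
    have cl: "close_maps W X (p \<circ> h) (\<lambda>_. \<nu> 1)" "close_maps W X (q \<circ> h) (\<lambda>_. \<nu> (2 * n + 1))"
      using e unfolding h(1) pq(1,2) Comp_clip[OF P O(1) h(2) pq(3)] Comp_clip[OF P O(1) h(2) pq(4)]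
        clip_eq_iff[OF O(1) coarsely_lipschitz_comp[OF h(2) pq(3)] uv]
        clip_eq_iff[OF O(1) coarsely_lipschitz_comp[OF h(2) pq(4)] uv] by blast+
    \<comment> \<open>Closeness to an isolated point is equality, so the projections of the lifted
      point are exactly the two tips.\<close>
    have isolated: "g (\<nu> 0) = \<nu> k"
      if g: "close_maps W X g (\<lambda>_. \<nu> k)" "g (\<nu> 0) \<in> pts X" and k: "odd k" for g k
    proof -
      obtain m where m: "g (\<nu> 0) = \<nu> m"
        using g(2) by (auto simp: X_def)
      have "edist X (\<nu> m) (\<nu> k) < \<infinity>"
        using g(1) m unfolding close_maps_def W_def
        by (auto intro: le_less_trans)
      then show ?thesis
        using k m by (cases "m = k") (auto simp: X_def \<nu>(1) star_def \<phi>_def)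
    qed
    have z: "h (\<nu> 0) \<in> pts P"
      using coarsely_lipschitz_image[OF h(2)] by (simp add: W_def)
    then have "p (h (\<nu> 0)) \<in> pts X" "q (h (\<nu> 0)) \<in> pts X"
      using pq(3,4)[THEN coarsely_lipschitz_image] by auto
    then have "p (h (\<nu> 0)) = \<nu> 1" "q (h (\<nu> 0)) = \<nu> (2 * n + 1)"
      using isolated[OF cl(1)] isolated[OF cl(2)] by simp_all
    then have "star \<phi> 0 (2 * n) \<le> ennreal \<kappa>"
      using \<kappa>(1)[OF z] by (simp add: Y_def f_def \<nu>(1) r_def)
    moreover have "of_nat n \<le> star \<phi> 0 (2 * n)"
      unfolding st of_nat_le_iff by simp
    ultimately have "ennreal (real n) \<le> ennreal \<kappa>"
      by (simp only: ennreal_of_nat_eq_real_of_nat)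
    then show False
      using n \<kappa>(2) by (simp add: ennreal_le_iff)
  qed
  ultimately show ?thesis
    by blast
qed

text \<open>The strict fibre product with the maximum metric serves as kernel pair:
  \<open>approx\<close> moves any pair with images at bounded distance into it by a bounded amount,
  which turns a square commuting up to closeness into a lift.\<close>

lemma exact_kernel_pair:
  assumes U: "set_universe U" and X: "X \<in> Obj (CLip U)" and Y: "Y \<in> Obj (CLip U)"
    and f: "coarsely_lipschitz X Y f"
    and approx: "\<And>r. \<exists>s. \<forall>x\<in>pts X. \<forall>x'\<in>pts X. edist Y (f x) (f x') \<le> ennreal r \<longrightarrow>
      (\<exists>z\<in>pts X. \<exists>z'\<in>pts X. f z = f z' \<and> edist X z x \<le> ennreal s \<and> edist X z' x' \<le> ennreal s)"
  obtains P p q where "kernel_pair (CLip U) X Y (clip X Y f) P (clip P X p) (clip P X q)"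
    "P \<in> Obj (CLip U)" "coarsely_lipschitz P X p" "coarsely_lipschitz P X q"
    "\<And>w. w \<in> pts P \<Longrightarrow> f (p w) = f (q w)"
    "\<And>x x'. x \<in> pts X \<Longrightarrow> x' \<in> pts X \<Longrightarrow> f x = f x' \<Longrightarrow> \<exists>w\<in>pts P. p w = x \<and> q w = x'"
proof -
  have Xm: "ext_metric X" and Ym: "ext_metric Y"
    using X Y by (simp_all add: Obj_CLip_iff)
  define S where "S = {z \<in> pts X \<times> pts X. f (fst z) = f (snd z)}"
  obtain \<iota> where \<iota>: "inj_on \<iota> (pts X \<times> pts X)" "\<And>S. S \<subseteq> pts X \<times> pts X \<Longrightarrow> \<iota> ` S \<in> U"
    using set_universe_pairs[OF U, of "pts X" "pts X"] X unfolding Obj_CLip_iff by blast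
  define p where "p = fst \<circ> inv_into S \<iota>"
  define q where "q = snd \<circ> inv_into S \<iota>"
  define P where "P = \<lparr>pts = \<iota> ` S, edist = (\<lambda>a b. max (edist X (p a) (p b)) (edist X (q a) (q b)))\<rparr>"
  have S: "S \<subseteq> pts X \<times> pts X"
    unfolding S_def by blast
  have P: "pts P = \<iota> ` S" "edist P a b = max (edist X (p a) (p b)) (edist X (q a) (q b))" for a b
    by (simp_all add: P_def)
  have pq: "p (\<iota> z) = fst z" "q (\<iota> z) = snd z" if "z \<in> S" for z
    using inv_into_f_f[OF inj_on_subset[OF \<iota>(1) S] that] by (simp_all add: p_def q_def)
  have im: "p w \<in> pts X" "q w \<in> pts X" "f (p w) = f (q w)" if "w \<in> pts P" for w
    using that pq unfolding P(1) S_def by auto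
  have ex: "\<exists>w\<in>pts P. p w = x \<and> q w = x'" if "x \<in> pts X" "x' \<in> pts X" "f x = f x'" for x x'
  proof
    have "(x, x') \<in> S"
      using that unfolding S_def by simp
    then show "\<iota> (x, x') \<in> pts P" "p (\<iota> (x, x')) = x \<and> q (\<iota> (x, x')) = x'"
      unfolding P(1) by (simp_all add: pq)
  qed
  have inj: "w = w'" if "w \<in> pts P" "w' \<in> pts P" "p w = p w'" "q w = q w'" for w w'
    using that unfolding P(1) by (auto simp: pq prod_eq_iff)
  have max0: "max a b = 0 \<longleftrightarrow> a = 0 \<and> b = 0" for a b :: ennreal
    by (metis max.bounded_iff max.idem order_refl zero_le order_antisym)
  have Pm: "ext_metric P"
    unfolding ext_metric_def
  proof (intro conjI ballI)
    fix a b assume ab: "a \<in> pts P" "b \<in> pts P"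
    show "edist P a b = 0 \<longleftrightarrow> a = b"
      using edist_zero_iff[OF Xm] im ab inj[OF ab] unfolding P(2) max0 by blast
    show "edist P a b = edist P b a"
      unfolding P(2) using edist_sym[OF Xm] im ab by metis
    fix c assume c: "c \<in> pts P"
    have "edist X (p a) (p c) \<le> edist X (p a) (p b) + edist X (p b) (p c)"
      "edist X (q a) (q c) \<le> edist X (q a) (q b) + edist X (q b) (q c)"
      using edist_triangle[OF Xm] im ab c by blast+
    then show "edist P a c \<le> edist P a b + edist P b c"
      unfolding P(2) by (intro max.boundedI) (erule order_trans, intro add_mono max.cobounded1 max.cobounded2)+
  qed
  have PO: "P \<in> Obj (CLip U)"
    using Pm \<iota>(2)[OF S] by (simp add: Obj_CLip_iff P(1))
  have p: "coarsely_lipschitz P X p" and q: "coarsely_lipschitz P X q"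
    using im by (auto intro!: coarsely_lipschitzI[of _ _ _ 1] simp: P(2) add_increasing)
  have "pullback (CLip U) X X Y (clip X Y f) (clip X Y f) P (clip P X p) (clip P X q)"
    unfolding pullback_def
  proof (intro conjI allI impI)
    show "mor (CLip U) X Y (clip X Y f)" "mor (CLip U) X Y (clip X Y f)"
      "mor (CLip U) P X (clip P X p)" "mor (CLip U) P X (clip P X q)"
      using X Y PO f p q mor_clip_iff by blast+
    have "close_maps P Y (f \<circ> p) (f \<circ> q)"
      using im coarsely_lipschitz_image[OF f]
      by (intro close_mapsI[of _ _ _ _ 0]) (simp add: image_subset_iff edist_self[OF Ym])
    then show "Comp (CLip U) (clip X Y f) (clip P X p) = Comp (CLip U) (clip X Y f) (clip P X q)"
      unfolding Comp_clip[OF X Y p f] Comp_clip[OF X Y q f]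
        clip_eq_iff[OF Y coarsely_lipschitz_comp[OF p f] coarsely_lipschitz_comp[OF q f]] .
    fix W \<phi> \<psi>
    assume "mor (CLip U) W X \<phi>" "mor (CLip U) W X \<psi>"
      and eq: "Comp (CLip U) (clip X Y f) \<phi> = Comp (CLip U) (clip X Y f) \<psi>"
    then obtain u v where uv: "\<phi> = clip W X u" "\<psi> = clip W X v" and W: "W \<in> Obj (CLip U)"
      and u: "coarsely_lipschitz W X u" and v: "coarsely_lipschitz W X v"
      unfolding mor_clip_iff by blast
    have "close_maps W Y (f \<circ> u) (f \<circ> v)"
      using eq unfolding uv Comp_clip[OF X Y u f] Comp_clip[OF X Y v f]
        clip_eq_iff[OF Y coarsely_lipschitz_comp[OF u f] coarsely_lipschitz_comp[OF v f]] .
    then obtain r where r: "\<And>w. w \<in> pts W \<Longrightarrow> edist Y (f (u w)) (f (v w)) \<le> ennreal r"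
      unfolding close_maps_def by auto
    obtain s where s: "\<And>x x'. x \<in> pts X \<Longrightarrow> x' \<in> pts X \<Longrightarrow> edist Y (f x) (f x') \<le> ennreal r \<Longrightarrow>
      (\<exists>z\<in>pts X. \<exists>z'\<in>pts X. f z = f z' \<and> edist X z x \<le> ennreal s \<and> edist X z' x' \<le> ennreal s)"
      using approx[of r] by metis
    have "\<exists>a\<in>pts P. edist X (p a) (u w) \<le> ennreal s \<and> edist X (q a) (v w) \<le> ennreal s"
      if w: "w \<in> pts W" for w
    proof -
      have "u w \<in> pts X" "v w \<in> pts X"
        using u v w coarsely_lipschitz_image by blast+
      then obtain z z' where z: "z \<in> pts X" "z' \<in> pts X" "f z = f z'"
        "edist X z (u w) \<le> ennreal s" "edist X z' (v w) \<le> ennreal s"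
        using s r[OF w] by blast
      obtain a where "a \<in> pts P" "p a = z" "q a = z'"
        using ex[OF z(1-3)] by blast
      then show ?thesis
        using z(4,5) by blast
    qed
    then obtain h where h: "\<And>w. w \<in> pts W \<Longrightarrow> h w \<in> pts P"
      "\<And>w. w \<in> pts W \<Longrightarrow> edist X (p (h w)) (u w) \<le> ennreal s"
      "\<And>w. w \<in> pts W \<Longrightarrow> edist X (q (h w)) (v w) \<le> ennreal s"
      by metis
    have cl: "close_maps W X (p \<circ> h) u" "close_maps W X (q \<circ> h) v"
      using h(2,3) by (auto intro: close_mapsI[of _ _ _ _ s])
    \<comment> \<open>The lift \<open>h\<close> was chosen pointwise; its control is inherited from
      \<open>u\<close> and \<open>v\<close>, coordinate by coordinate.\<close>
    have ph: "coarsely_lipschitz W X (p \<circ> h)" and qh: "coarsely_lipschitz W X (q \<circ> h)"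
      using h(1) im by (auto intro!: coarsely_lipschitz_close[OF Xm u _ cl(1)] coarsely_lipschitz_close[OF Xm v _ cl(2)])
    obtain K where K: "K > 0"
      "\<And>x x'. x \<in> pts W \<Longrightarrow> x' \<in> pts W \<Longrightarrow> edist X ((p \<circ> h) x) ((p \<circ> h) x') \<le> ennreal K * (1 + edist W x x')"
      using ph by (rule coarsely_lipschitzE) blast
    obtain L where L: "L > 0"
      "\<And>x x'. x \<in> pts W \<Longrightarrow> x' \<in> pts W \<Longrightarrow> edist X ((q \<circ> h) x) ((q \<circ> h) x') \<le> ennreal L * (1 + edist W x x')"
      using qh by (rule coarsely_lipschitzE) blast
    have hCL: "coarsely_lipschitz W P h"
    proof (rule coarsely_lipschitzI[of _ _ _ "max K L"])
      fix x x' assume x: "x \<in> pts W" "x' \<in> pts W"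
      show "edist P (h x) (h x') \<le> ennreal (max K L) * (1 + edist W x x')"
        unfolding P(2)
      proof (rule max.boundedI)
        show "edist X (p (h x)) (p (h x')) \<le> ennreal (max K L) * (1 + edist W x x')"
          by (rule order_trans[OF K(2)[OF x, unfolded comp_def]]) (intro mult_right_mono ennreal_leI, auto)
        show "edist X (q (h x)) (q (h x')) \<le> ennreal (max K L) * (1 + edist W x x')"
          by (rule order_trans[OF L(2)[OF x, unfolded comp_def]]) (intro mult_right_mono ennreal_leI, auto)
      qed
    qed (rule h(1))
    show "\<exists>!\<eta>. mor (CLip U) W P \<eta> \<and> Comp (CLip U) (clip P X p) \<eta> = \<phi> \<and> Comp (CLip U) (clip P X q) \<eta> = \<psi>"
    proof
      show "mor (CLip U) W P (clip W P h) \<and> Comp (CLip U) (clip P X p) (clip W P h) = \<phi> \<and>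
          Comp (CLip U) (clip P X q) (clip W P h) = \<psi>"
        unfolding uv Comp_clip[OF PO X hCL p] Comp_clip[OF PO X hCL q] clip_eq_iff[OF X ph u] clip_eq_iff[OF X qh v]
        using W PO hCL cl mor_clip_iff by blast
      fix \<eta> assume \<eta>: "mor (CLip U) W P \<eta> \<and> Comp (CLip U) (clip P X p) \<eta> = \<phi> \<and> Comp (CLip U) (clip P X q) \<eta> = \<psi>"
      then obtain h' where h': "\<eta> = clip W P h'" "coarsely_lipschitz W P h'"
        unfolding mor_clip_iff by blast
      note h'pq = coarsely_lipschitz_comp[OF h'(2) p] coarsely_lipschitz_comp[OF h'(2) q]
      have "clip W X (p \<circ> h') = clip W X u" "clip W X (q \<circ> h') = clip W X v"
        using \<eta> unfolding h'(1) uv Comp_clip[OF PO X h'(2) p] Comp_clip[OF PO X h'(2) q] by blast+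
      moreover have "clip W X (p \<circ> h) = clip W X u" "clip W X (q \<circ> h) = clip W X v"
        unfolding clip_eq_iff[OF X ph u] clip_eq_iff[OF X qh v] by (rule cl)+
      ultimately have "clip W X (p \<circ> h') = clip W X (p \<circ> h)" "clip W X (q \<circ> h') = clip W X (q \<circ> h)"
        by simp_all
      then have "close_maps W X (p \<circ> h') (p \<circ> h)" "close_maps W X (q \<circ> h') (q \<circ> h)"
        unfolding clip_eq_iff[OF X h'pq(1) ph] clip_eq_iff[OF X h'pq(2) qh] .
      then obtain k l where kl: "\<And>w. w \<in> pts W \<Longrightarrow> edist X (p (h' w)) (p (h w)) \<le> ennreal k"
        "\<And>w. w \<in> pts W \<Longrightarrow> edist X (q (h' w)) (q (h w)) \<le> ennreal l"
        unfolding close_maps_def by auto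
      have "close_maps W P h' h"
      proof (rule close_mapsI)
        fix w assume w: "w \<in> pts W"
        show "edist P (h' w) (h w) \<le> ennreal (max k l)"
          unfolding P(2) by (intro max.boundedI order_trans[OF kl(1)[OF w]] order_trans[OF kl(2)[OF w]] ennreal_leI) auto
      qed
      then show "\<eta> = clip W P h"
        unfolding h'(1) clip_eq_iff[OF PO h'(2) hCL] .
    qed
  qed
  then show ?thesis
    using that[of P p q] PO p q im(3) ex unfolding kernel_pair_def by blast
qed

text \<open>The space \<open>Y\<close> is a bouquet of edges of growing lengths glued at one endpoint, and \<open>X\<close> is the disjoint
  union of these edges. A bounded pair in different edges can be moved to the glued endpoints, but a
  section would map the connected bouquet into a single edge.\<close>

lemma effective_epi_not_split_epi:
  assumes U: "set_universe (U :: 'u set set)"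
  shows "\<exists>X Y f. effective_epi (CLip U) X Y f \<and> \<not> split_epi (CLip U) X Y f"
proof -
  obtain \<nu> :: "nat \<Rightarrow> 'u" where \<nu>: "inj \<nu>" "\<And>S. \<nu> ` S \<in> U"
    using set_universe_nat[OF U] by blast
  define \<phi> :: "nat \<Rightarrow> ennreal" where "\<phi> n = of_nat (n + 1)" for n
  \<comment> \<open>Edge \<open>k\<close> consists of \<open>2 * k\<close> and
    \<open>2 * k + 1\<close>. The map \<open>r\<close> glues the even ends to
    \<open>0\<close>.\<close>
  define \<delta> where "\<delta> m n = (if m div 2 = n div 2 then star \<phi> m n else \<infinity>)" for m n :: nat
  define T :: "nat set" where "T = {n. n = 0 \<or> odd n}"
  define r where "r n = (if even n then 0 else n)" for n :: nat
  define X where "X = nat_space \<nu> UNIV \<delta>"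
  define Y where "Y = nat_space \<nu> T (star \<phi>)"
  define f where "f = nat_map \<nu> r"
  have \<phi>0: "\<phi> n \<noteq> 0" for n
    by (simp add: \<phi>_def)
  have \<phi>_le: "\<phi> m \<le> \<phi> n" if "m \<le> n" for m n
    using that unfolding \<phi>_def of_nat_le_iff by simp
  have "ext_metric X"
    unfolding X_def
  proof (rule ext_metric_nat_space[OF \<nu>(1)])
    show "\<delta> m n = 0 \<longleftrightarrow> m = n" "\<delta> m n = \<delta> n m" for m n
      using \<phi>0[of m] by (auto simp: \<delta>_def star_def add.commute)
    show "\<delta> l n \<le> \<delta> l m + \<delta> m n" for l m n
      by (auto simp: \<delta>_def star_def add.assoc intro!: add_left_mono add_increasing)
  qed
  then have X: "X \<in> Obj (CLip U)"
    using \<nu>(2) by (simp add: Obj_CLip_iff X_def)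
  have Y: "Y \<in> Obj (CLip U)"
    using \<nu> ext_metric_star[OF \<nu>(1) \<phi>0] by (simp add: Obj_CLip_iff Y_def)
  have px: "pts X = range \<nu>" "pts Y = \<nu> ` T" "edist X (\<nu> m) (\<nu> n) = \<delta> m n" "edist Y (\<nu> m) (\<nu> n) = star \<phi> m n"
    "f (\<nu> n) = \<nu> (r n)" for m n
    by (simp_all add: X_def Y_def f_def \<nu>(1))
  have rT: "r n \<in> T" "r n \<le> n" for n
    by (auto simp: r_def T_def)
  have f: "coarsely_lipschitz X Y f"
    unfolding X_def Y_def f_def
  proof (rule coarsely_lipschitz_nat_space[OF \<nu>(1) rT(1), where K = 1])
    fix m n
    have "star \<phi> (r m) (r n) \<le> \<delta> m n"
      using rT(2) by (auto simp: \<delta>_def star_def intro!: add_mono \<phi>_le)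
    then show "star \<phi> (r m) (r n) \<le> ennreal 1 * (1 + \<delta> m n)"
      by (simp add: add_increasing)
  qed
  have epi: "epi (CLip U) X Y (clip X Y f)"
  proof (rule epi_clipI[OF X Y f])
    fix y assume "y \<in> pts Y"
    then show "\<exists>x\<in>pts X. f x = y"
      by (intro bexI[of _ y]) (auto simp: px T_def r_def)
  qed
  have \<delta>_base: "\<delta> (2 * (n div 2)) n \<le> \<phi> n + \<phi> n" for n
    by (auto simp: \<delta>_def star_def intro!: add_mono \<phi>_le)
  have "\<exists>s. \<forall>x\<in>pts X. \<forall>x'\<in>pts X. edist Y (f x) (f x') \<le> ennreal c \<longrightarrow>
      (\<exists>z\<in>pts X. \<exists>z'\<in>pts X. f z = f z' \<and> edist X z x \<le> ennreal s \<and> edist X z' x' \<le> ennreal s)" for c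
  proof -
    have "\<exists>z\<in>pts X. \<exists>z'\<in>pts X. f z = f z' \<and> edist X z (\<nu> m) \<le> ennreal (2 * \<bar>c\<bar>) \<and>
        edist X z' (\<nu> n) \<le> ennreal (2 * \<bar>c\<bar>)"
      if c: "star \<phi> (r m) (r n) \<le> ennreal c" for m n
    proof (cases "r m = r n")
      case True
      show ?thesis
        by (rule bexI[of _ "\<nu> m"], rule bexI[of _ "\<nu> n"]) (simp_all add: px \<delta>_def star_def True)
    next
      case False
      have small: "\<delta> (2 * (k div 2)) k \<le> ennreal (2 * \<bar>c\<bar>)" if k: "k = m \<or> k = n" for k
      proof (cases "even k")
        case True
        then show ?thesis
          by (simp add: \<delta>_def star_def)
      next
        case odd: False
        \<comment> \<open>An odd \<open>k\<close> is fixed by \<open>r\<close>, so its weight is one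
          of the two summands.\<close>
        have "\<phi> k \<le> star \<phi> (r m) (r n)"
          using False k odd by (auto simp: star_def r_def add_increasing add_increasing2)
        then have "\<phi> k \<le> ennreal \<bar>c\<bar>"
          by (rule order_trans[OF _ order_trans[OF c ennreal_leI[OF abs_ge_self]]])
        then have "\<phi> k + \<phi> k \<le> ennreal \<bar>c\<bar> + ennreal \<bar>c\<bar>"
          by (intro add_mono)
        also have "\<dots> = ennreal (2 * \<bar>c\<bar>)"
          by (simp flip: ennreal_plus)
        finally show ?thesis
          by (rule order_trans[OF \<delta>_base])
      qed
      \<comment> \<open>Each point goes to the even end of its own edge; these ends share the image
        \<open>0\<close>.\<close>
      show ?thesis
        by (rule bexI[of _ "\<nu> (2 * (m div 2))"], rule bexI[of _ "\<nu> (2 * (n div 2))"])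
          (simp_all add: px r_def small)
    qed
    then show ?thesis
      by (intro exI[of _ "2 * \<bar>c\<bar>"]) (auto simp: px)
  qed
  then obtain P p q where kp: "kernel_pair (CLip U) X Y (clip X Y f) P (clip P X p) (clip P X q)"
    and P: "P \<in> Obj (CLip U)" and p: "coarsely_lipschitz P X p" and q: "coarsely_lipschitz P X q"
    and pq: "\<And>w. w \<in> pts P \<Longrightarrow> f (p w) = f (q w)"
    and ex: "\<And>x x'. x \<in> pts X \<Longrightarrow> x' \<in> pts X \<Longrightarrow> f x = f x' \<Longrightarrow> \<exists>w\<in>pts P. p w = x \<and> q w = x'"
    by (rule exact_kernel_pair[OF U X Y f]) blast
  have "coequaliser (CLip U) P X Y (clip P X p) (clip P X q) (clip X Y f)"
  proof (rule coequaliser_clipI[OF P X Y p q f _ epi])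
    show "close_maps P Y (f \<circ> p) (f \<circ> q)"
    proof (rule close_mapsI[of _ _ _ _ 0])
      fix w assume w: "w \<in> pts P"
      then have "f (q w) \<in> pts Y"
        using coarsely_lipschitz_image[OF f] coarsely_lipschitz_image[OF q] by blast
      then show "edist Y ((f \<circ> p) w) ((f \<circ> q) w) \<le> ennreal 0"
        using pq[OF w] Y by (simp add: Obj_CLip_iff edist_self)
    qed
    fix Z h
    assume "Z \<in> Obj (CLip U)" and h: "coarsely_lipschitz X Z h" and "close_maps P Z (h \<circ> p) (h \<circ> q)"
    then obtain \<kappa> where \<kappa>: "\<kappa> \<ge> 0" "\<And>w. w \<in> pts P \<Longrightarrow> edist Z (h (p w)) (h (q w)) \<le> ennreal \<kappa>"
      and Z: "ext_metric Z"
      unfolding close_maps_def comp_def Obj_CLip_iff by blast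
    have fib: "edist Z (h (\<nu> m)) (h (\<nu> n)) \<le> ennreal \<kappa>" if "r m = r n" for m n
    proof -
      have "\<exists>w\<in>pts P. p w = \<nu> m \<and> q w = \<nu> n"
        using that by (intro ex) (simp_all add: px)
      then show ?thesis
        using \<kappa>(2) by metis
    qed
    obtain L where L: "L > 0" "\<And>x. x \<in> pts X \<Longrightarrow> h x \<in> pts Z"
      "\<And>x x'. x \<in> pts X \<Longrightarrow> x' \<in> pts X \<Longrightarrow> edist Z (h x) (h x') \<le> ennreal L * (1 + edist X x x')"
      using h by (rule coarsely_lipschitzE) blast
    have hZ: "h (\<nu> n) \<in> pts Z" for n
      using L(2) by (simp add: px)
    have edge: "edist Z (h (\<nu> (2 * (n div 2)))) (h (\<nu> n)) \<le> ennreal L * (1 + (\<phi> n + \<phi> n))" for n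
    proof -
      have "edist Z (h (\<nu> (2 * (n div 2)))) (h (\<nu> n)) \<le> ennreal L * (1 + \<delta> (2 * (n div 2)) n)"
        using L(3)[of "\<nu> (2 * (n div 2))" "\<nu> n"] by (simp add: px)
      also have "\<dots> \<le> ennreal L * (1 + (\<phi> n + \<phi> n))"
        by (intro mult_left_mono add_left_mono \<delta>_base) auto
      finally show ?thesis .
    qed
    have "edist Z (h (\<nu> m)) (h (\<nu> n)) \<le> ennreal (2 * L + \<kappa>) * (1 + star \<phi> m n)" for m n
    proof (cases "m = n")
      case True
      then show ?thesis
        using edist_self[OF Z hZ] by simp
    next
      case False
      \<comment> \<open>The even ends of two edges lie in one fibre of \<open>f\<close>, so their
        images under \<open>h\<close> are at most \<kappa> apart: the route from one edge to another
        passes through them.\<close>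
      define b where "b k = h (\<nu> (2 * (k div 2)))" for k
      have bZ: "b k \<in> pts Z" for k
        unfolding b_def by (rule hZ)
      have "edist Z (h (\<nu> m)) (h (\<nu> n)) \<le> edist Z (h (\<nu> m)) (b m) + (edist Z (b m) (b n) + edist Z (b n) (h (\<nu> n)))"
        using edist_triangle[OF Z hZ bZ hZ] edist_triangle[OF Z bZ bZ hZ] by (meson add_left_mono order_trans)
      also have "edist Z (h (\<nu> m)) (b m) = edist Z (b m) (h (\<nu> m))"
        by (rule edist_sym[OF Z hZ bZ])
      also have "edist Z (b m) (h (\<nu> m)) + (edist Z (b m) (b n) + edist Z (b n) (h (\<nu> n)))
          \<le> ennreal L * (1 + (\<phi> m + \<phi> m)) + (ennreal \<kappa> * 1 + ennreal L * (1 + (\<phi> n + \<phi> n)))"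
        unfolding b_def by (intro add_mono edge) (simp add: fib r_def)
      also have "\<dots> \<le> ennreal L * (1 + (\<phi> m + \<phi> m)) +
          (ennreal \<kappa> * (1 + (\<phi> m + \<phi> n)) + ennreal L * (1 + (\<phi> n + \<phi> n)))"
        by (intro add_mono order_refl mult_left_mono) auto
      also have "\<dots> = (ennreal L + ennreal L + ennreal \<kappa>) * (1 + (\<phi> m + \<phi> n))"
        by (simp add: distrib_left distrib_right ac_simps)
      also have "ennreal L + ennreal L + ennreal \<kappa> = ennreal (2 * L + \<kappa>)"
        using L(1) \<kappa>(1) by (simp flip: ennreal_plus)
      finally show ?thesis
        using False by (simp add: star_def)
    qed
    then have "coarsely_lipschitz Y Z h"
      using hZ by (intro coarsely_lipschitzI[of _ _ _ "2 * L + \<kappa>"]) (auto simp: px)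
    moreover have "close_maps X Z (h \<circ> f) h"
      by (rule close_mapsI[of _ _ _ _ \<kappa>]) (auto simp: px r_def intro!: fib)
    ultimately show "\<exists>k. coarsely_lipschitz Y Z k \<and> close_maps X Z (k \<circ> f) h"
      by blast
  qed
  then have "effective_epi (CLip U) X Y (clip X Y f)"
    using epi kp unfolding effective_epi_def by blast
  moreover have "\<not> split_epi (CLip U) X Y (clip X Y f)"
  proof
    assume "split_epi (CLip U) X Y (clip X Y f)"
    then obtain \<sigma> where "mor (CLip U) Y X \<sigma>" and eq: "Comp (CLip U) (clip X Y f) \<sigma> = Ident (CLip U) Y"
      unfolding split_epi_def by blast
    then obtain s where s: "\<sigma> = clip Y X s" "coarsely_lipschitz Y X s"
      unfolding mor_clip_iff by blast
    have "close_maps Y Y (f \<circ> s) (\<lambda>x. x)"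
      using eq unfolding s(1) Comp_clip[OF X Y s(2) f] Ident_clip
        clip_eq_iff[OF Y coarsely_lipschitz_comp[OF s(2) f] coarsely_lipschitz_id] .
    then obtain \<kappa> where \<kappa>: "\<kappa> \<ge> 0" "\<And>y. y \<in> pts Y \<Longrightarrow> edist Y (f (s y)) y \<le> ennreal \<kappa>"
      unfolding close_maps_def comp_def by blast
    obtain L where L: "L > 0" "\<And>x. x \<in> pts Y \<Longrightarrow> s x \<in> pts X"
      "\<And>x x'. x \<in> pts Y \<Longrightarrow> x' \<in> pts Y \<Longrightarrow> edist X (s x) (s x') \<le> ennreal L * (1 + edist Y x x')"
      using s(2) by (rule coarsely_lipschitzE) blast
    have "\<exists>m. s (\<nu> n) = \<nu> m" if "n \<in> T" for n
      using L(2)[of "\<nu> n"] that by (auto simp: px)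
    then obtain t where t: "\<And>n. n \<in> T \<Longrightarrow> s (\<nu> n) = \<nu> (t n)"
      by metis
    \<comment> \<open>Beyond \<open>t 0\<close>, so that edge \<open>k\<close> is not the one
      containing \<open>t 0\<close>; beyond \<kappa>, so that missing the odd end of edge
      \<open>k\<close> costs too much.\<close>
    obtain k where k: "real (t 0) + \<kappa> < real k"
      using reals_Archimedean2 by blast
    define n where "n = 2 * k + 1"
    have T: "0 \<in> T" "n \<in> T"
      by (simp_all add: T_def n_def)
    \<comment> \<open>A finite distance in \<open>Y\<close> stays finite under \<open>s\<close>,
      hence all of \<open>Y\<close> lands in the edge of \<open>t 0\<close>.\<close>
    have "\<delta> (t 0) (t n) \<le> ennreal L * (1 + star \<phi> 0 n)"
      using L(3)[of "\<nu> 0" "\<nu> n"] T t by (simp add: px)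
    also have "\<dots> < \<infinity>"
      by (simp add: star_def \<phi>_def ennreal_mult_less_top of_nat_less_top)
    finally have "t n div 2 = t 0 div 2"
      by (auto simp: \<delta>_def split: if_splits)
    moreover have "t 0 < k"
      using k \<kappa>(1) by linarith
    ultimately have "r (t n) \<noteq> n"
      by (auto simp: r_def n_def)
    then have "\<phi> n \<le> star \<phi> (r (t n)) n"
      by (simp add: star_def add_increasing)
    also have "\<dots> \<le> ennreal \<kappa>"
      using \<kappa>(2)[of "\<nu> n"] T t by (simp add: px)
    finally have "ennreal (real (n + 1)) \<le> ennreal \<kappa>"
      by (simp only: \<phi>_def ennreal_of_nat_eq_real_of_nat)
    then have "real (n + 1) \<le> \<kappa>"
      using \<kappa>(1) by (simp only: ennreal_le_iff)
    then show False
      using k by (simp add: n_def)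
  qed
  ultimately show ?thesis
    by blast
qed

theorem theorem1p2:
  fixes U :: "'u set set"
  assumes "set_universe U"
  shows
    "((\<forall>X Y f. effective_epi (CLip U) X Y f \<longrightarrow> regular_epi (CLip U) X Y f) \<and>
      (\<forall>X Y f. split_epi (CLip U) X Y f \<longrightarrow> regular_epi (CLip U) X Y f) \<and>
      (\<forall>X Y f. regular_epi (CLip U) X Y f \<longrightarrow> strong_epi (CLip U) X Y f) \<and>
      (\<forall>X Y f. strong_epi (CLip U) X Y f \<longrightarrow> extremal_epi (CLip U) X Y f) \<and>
      (\<forall>X Y f. extremal_epi (CLip U) X Y f \<longrightarrow> epi (CLip U) X Y f) \<and>
      (\<forall>X Y f. extremal_epi (CLip U) X Y f \<longrightarrow> regular_epi (CLip U) X Y f) \<and>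
      (\<forall>X Y f. (regular_epi (CLip U) X Y f \<longleftrightarrow> strong_epi (CLip U) X Y f) \<and>
               (strong_epi (CLip U) X Y f \<longleftrightarrow> extremal_epi (CLip U) X Y f))) \<and>
     ((\<exists>X Y f. epi (CLip U) X Y f \<and> \<not> extremal_epi (CLip U) X Y f) \<and>
      (\<exists>X Y f. regular_epi (CLip U) X Y f \<and> \<not> effective_epi (CLip U) X Y f) \<and>
      (\<exists>X Y f. regular_epi (CLip U) X Y f \<and> \<not> split_epi (CLip U) X Y f) \<and>
      (\<exists>X Y f. split_epi (CLip U) X Y f \<and> \<not> effective_epi (CLip U) X Y f) \<and>
      (\<exists>X Y f. effective_epi (CLip U) X Y f \<and> \<not> split_epi (CLip U) X Y f))"
proof -
  note C = category_CLip[of U]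
  note reg_imp_str = regular_epi_imp_strong_epi[OF C]
  note str_imp_ext = strong_epi_imp_extremal_epi[OF C]
  note ext_imp_reg = extremal_epi_imp_regular_epi[OF assms]
  note str_imp_reg = ext_imp_reg[OF str_imp_ext]
  note ext_imp_str = reg_imp_str[OF ext_imp_reg]
  note eff_imp_reg = effective_epi_imp_regular_epi
  note spl_imp_reg = split_epi_imp_regular_epi[OF C]
  have ext_imp_epi: "epi (CLip U) X Y f" if "extremal_epi (CLip U) X Y f" for X Y f
    using that unfolding extremal_epi_def by blast
  note split_not_eff = split_epi_not_effective_epi[OF assms]
  note eff_not_split = effective_epi_not_split_epi[OF assms]
  \<comment> \<open>Split and effective epis are regular, so the last two examples serve
    twice.\<close>
  have reg_not_eff: "\<exists>X Y f. regular_epi (CLip U) X Y f \<and> \<not> effective_epi (CLip U) X Y f"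
    using split_not_eff spl_imp_reg by metis
  have reg_not_split: "\<exists>X Y f. regular_epi (CLip U) X Y f \<and> \<not> split_epi (CLip U) X Y f"
    using eff_not_split eff_imp_reg by metis
  show ?thesis
    by (intro conjI allI impI iffI)
      (rule epi_not_extremal_epi[OF assms] reg_not_eff reg_not_split split_not_eff eff_not_split |
       erule reg_imp_str str_imp_ext ext_imp_reg str_imp_reg ext_imp_str eff_imp_reg spl_imp_reg ext_imp_epi)+
qed

end
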